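(* Let $i\geq 3$ and $j\geq 2i+1$ be integers. Then for every $n$, every $n$-vertex simple graph $G$ that is $(i,j)$-critical (in the DP sense defined in the context) satisfies $$|E(G)|\geq \frac{(2i+1)n+j-i+1}{i+1};$$ equivalently, $g_{DP}(i,j,n)\geq \frac{(2i+1)n+j-i+1}{i+1}$. Moreover, this bound is sharp: for each such pair $(i,j)$ there are infinitely many $n$ for which there exists an $n$-vertex $(i,j)$-critical simple graph with exactly $\frac{(2i+1)n+j-i+1}{i+1}$ edges.
   Context: Let $G$ be a simple graph. A 2-fold cover of $G$ is a pair $\mathcal{H}=(L,H)$ where $H$ is a graph and $L:V(G)\to 2^{V(H)}$ is such that: the sets $L(u)$, $u\in V(G)$, partition $V(H)$; $|L(u)|=2$ and $H[L(u)]$ is complete for every $u$; if there is an edge of $H$ between $L(u)$ and $L(v)$ with $u\neq v$ then $uv\in E(G)$; and for each edge $uv\in E(G)$ the edges of $H$ between $L(u)$ and $L(v)$ form a matching. For each $u$, the two vertices of $L(u)$ are designated as $p(u)$ (poor) and $r(u)$ (rich). An $\mathcal{H}$-map is a function $\phi:V(G)\to V(H)$ with $\phi(v)\in L(v)$ for all $v$; $H_\phi$ denotes the subgraph of $H$ induced by $\phi(V(G))$. For integers $0\le i\le j$, an $\mathcal{H}$-map $\phi$ is an $(i,j)$-defective $\mathcal{H}$-coloring if every poor vertex in $H_\phi$ has degree at most $i$ in $H_\phi$ and every rich vertex in $H_\phi$ has degree at most $j$ in $H_\phi$. $G$ is $(i,j)$-colorable if it has such a coloring for every 2-fold cover $\mathcal{H}$,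 and $(i,j)$-critical if it is not $(i,j)$-colorable but every proper subgraph is. $g_{DP}(i,j,n)$ denotes the minimum number of edges of an $n$-vertex $(i,j)$-critical simple graph. *)

theory Defs
  imports Complex_Main "HOL-Library.Disjoint_Sets" "HOL-Library.Extended_Real"
begin

record 'v ugraph =
  verts :: "'v set"
  edges :: "'v set set"

definition simple_graph :: "'v ugraph \<Rightarrow> bool" where
  "simple_graph G \<longleftrightarrow> finite (verts G) \<and> (\<forall>e\<in>edges G. e \<subseteq> verts G \<and> card e = 2)"

definition proper_subgraph :: "'v ugraph \<Rightarrow> 'v ugraph \<Rightarrow> bool" where
  "proper_subgraph G' G \<longleftrightarrow>
     simple_graph G' \<and> verts G' \<subseteq> verts G \<and> edges G' \<subseteq> edges G \<and> G' \<noteq> G"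

definition induced :: "'v ugraph \<Rightarrow> 'v set \<Rightarrow> 'v ugraph" where
  "induced G S = \<lparr>verts = verts G \<inter> S, edges = {e \<in> edges G. e \<subseteq> S}\<rparr>"

definition graph_degree :: "'v ugraph \<Rightarrow> 'v \<Rightarrow> nat" where
  "graph_degree G v = card {e \<in> edges G. v \<in> e}"

definition complete_graph :: "'v ugraph \<Rightarrow> bool" where
  "complete_graph G \<longleftrightarrow> (\<forall>x\<in>verts G. \<forall>y\<in>verts G. x \<noteq> y \<longrightarrow> {x, y} \<in> edges G)"

definition edges_between :: "'v ugraph \<Rightarrow> 'v set \<Rightarrow> 'v set \<Rightarrow> 'v set set" where
  "edges_between G A B = {{x, y} | x y. x \<in> A \<and> y \<in> B \<and> {x, y} \<in> edges G}"

text \<open>In \<open>two_fold_cover\<close>, the edge set between two lists is a matching iff its members,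
  as two-element sets, are pairwise disjoint (\<open>disjoint\<close>).\<close>

definition two_fold_cover :: "'v ugraph \<Rightarrow> ('v \<Rightarrow> 'h set) \<Rightarrow> 'h ugraph \<Rightarrow> bool" where
  "two_fold_cover G L H \<longleftrightarrow>
     simple_graph H \<and>
     (\<Union>u\<in>verts G. L u) = verts H \<and> disjoint_family_on L (verts G) \<and>
     (\<forall>u\<in>verts G. card (L u) = 2 \<and> complete_graph (induced H (L u))) \<and>
     (\<forall>u\<in>verts G. \<forall>v\<in>verts G. u \<noteq> v \<longrightarrow>
        edges_between H (L u) (L v) \<noteq> {} \<longrightarrow> {u, v} \<in> edges G) \<and>
     (\<forall>u v. {u, v} \<in> edges G \<longrightarrow> disjoint (edges_between H (L u) (L v)))"

text \<open>The designation of the poor vertex \<open>p u\<close> and the rich vertex \<open>r u\<close> of each list;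
  they are distinct because lists of a 2-fold cover have two elements.\<close>

definition poor_rich :: "'v ugraph \<Rightarrow> ('v \<Rightarrow> 'h set) \<Rightarrow> ('v \<Rightarrow> 'h) \<Rightarrow> ('v \<Rightarrow> 'h) \<Rightarrow> bool" where
  "poor_rich G L p r \<longleftrightarrow> (\<forall>u\<in>verts G. L u = {p u, r u})"

definition cover_map :: "'v ugraph \<Rightarrow> ('v \<Rightarrow> 'h set) \<Rightarrow> ('v \<Rightarrow> 'h) \<Rightarrow> bool" where
  "cover_map G L \<phi> \<longleftrightarrow> (\<forall>v\<in>verts G. \<phi> v \<in> L v)"

definition defective_coloring ::
  "nat \<Rightarrow> nat \<Rightarrow> 'v ugraph \<Rightarrow> ('v \<Rightarrow> 'h set) \<Rightarrow> 'h ugraph \<Rightarrow> ('v \<Rightarrow> 'h) \<Rightarrow> ('v \<Rightarrow> 'h) \<Rightarrow>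
   ('v \<Rightarrow> 'h) \<Rightarrow> bool" where
  "defective_coloring i j G L H p r \<phi> \<longleftrightarrow>
     cover_map G L \<phi> \<and>
     (let H\<phi> = induced H (\<phi> ` verts G) in
        (\<forall>x \<in> verts H\<phi> \<inter> p ` verts G. graph_degree H\<phi> x \<le> i) \<and>
        (\<forall>x \<in> verts H\<phi> \<inter> r ` verts G. graph_degree H\<phi> x \<le> j))"

text \<open>Covers of a finite graph are finite, so up to isomorphism their vertices are natural
  numbers. Hence quantifying over covers with vertices of type \<open>nat\<close> is no restriction;
  see \<open>DP_colorable_any_type\<close> below.\<close>

definition DP_colorable :: "nat \<Rightarrow> nat \<Rightarrow> 'v ugraph \<Rightarrow> bool" where
  "DP_colorable i j G \<longleftrightarrow>
     (\<forall>(L :: 'v \<Rightarrow> nat set) H p r. two_fold_cover G L H \<and> poor_rich G L p r \<longrightarrow>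
        (\<exists>\<phi>. defective_coloring i j G L H p r \<phi>))"

lemma edges_betweenI:
  "x \<in> A \<Longrightarrow> y \<in> B \<Longrightarrow> {x, y} \<in> edges G \<Longrightarrow> {x, y} \<in> edges_between G A B"
  unfolding edges_between_def by blast

lemma DP_colorable_any_type:
  fixes G :: "'v ugraph" and L :: "'v \<Rightarrow> 'h set"
  assumes col: "DP_colorable i j G" and G: "simple_graph G"
    and cov: "two_fold_cover G L H" and pr: "poor_rich G L p r"
  shows "\<exists>\<phi>. defective_coloring i j G L H p r \<phi>"
proof -
  have sH: "simple_graph H" and part: "(\<Union>u\<in>verts G. L u) = verts H"
    and dis: "disjoint_family_on L (verts G)"
    and compl: "\<And>u. u \<in> verts G \<Longrightarrow> card (L u) = 2 \<and> complete_graph (induced H (L u))"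
    and cross: "\<And>u v. u \<in> verts G \<Longrightarrow> v \<in> verts G \<Longrightarrow> u \<noteq> v \<Longrightarrow>
      edges_between H (L u) (L v) \<noteq> {} \<Longrightarrow> {u, v} \<in> edges G"
    and match: "\<And>u v. {u, v} \<in> edges G \<Longrightarrow> disjoint (edges_between H (L u) (L v))"
    using cov unfolding two_fold_cover_def by auto
  obtain f :: "'h \<Rightarrow> nat" where f: "inj_on f (verts H)"
    using sH finite_imp_inj_to_nat_seg[of "verts H"] unfolding simple_graph_def by auto
  have fin: "finite (verts H)" and Esub: "\<And>e. e \<in> edges H \<Longrightarrow> e \<subseteq> verts H"
    and Ecard: "\<And>e. e \<in> edges H \<Longrightarrow> card e = 2"
    using sH by (auto simp: simple_graph_def)
  have Lsub: "L u \<subseteq> verts H" if "u \<in> verts G" for u using part that by auto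
  define H' where "H' = \<lparr>verts = f ` verts H, edges = (`) f ` edges H\<rparr>"
  define L' where "L' = (\<lambda>u. f ` L u)"
  have mem: "f ` e \<in> edges H' \<longleftrightarrow> e \<in> edges H" if "e \<subseteq> verts H" for e
    using that Esub inj_on_image_eq_iff[OF f] by (auto simp: H'_def)
  have mem2: "{f x, f y} \<in> edges H' \<longleftrightarrow> {x, y} \<in> edges H"
    if "x \<in> verts H" "y \<in> verts H" for x y using mem[of "{x, y}"] that by auto
  have eb: "edges_between H' (L' u) (L' v) = (`) f ` edges_between H (L u) (L v)"
    if "u \<in> verts G" "v \<in> verts G" for u v
  proof (intro set_eqI iffI)
    fix e assume "e \<in> edges_between H' (L' u) (L' v)"
    then obtain x y where xy: "x \<in> L u" "y \<in> L v" "e = {f x, f y}" "e \<in> edges H'"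
      unfolding edges_between_def L'_def by auto
    have "x \<in> verts H" "y \<in> verts H" using Lsub that xy(1,2) by (meson subsetD)+
    then have "{x, y} \<in> edges H" using mem2 xy(3,4) by simp
    then have "{x, y} \<in> edges_between H (L u) (L v)"
      by (rule edges_betweenI[OF xy(1,2)])
    then show "e \<in> (`) f ` edges_between H (L u) (L v)"
      by (rule rev_image_eqI) (simp add: xy(3))
  next
    fix e assume "e \<in> (`) f ` edges_between H (L u) (L v)"
    then obtain x y where xy: "x \<in> L u" "y \<in> L v" "e = {f x, f y}" "{x, y} \<in> edges H"
      unfolding edges_between_def by auto
    have "x \<in> verts H" "y \<in> verts H" using Lsub that xy(1,2) by (meson subsetD)+
    then have "{f x, f y} \<in> edges H'" using mem2 xy(4) by simp
    then show "e \<in> edges_between H' (L' u) (L' v)"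
      unfolding xy(3) L'_def by (rule edges_betweenI[OF imageI[OF xy(1)] imageI[OF xy(2)]])
  qed
  have ebsub: "edges_between H A B \<subseteq> edges H" for A B
    by (auto simp: edges_between_def)
  have "two_fold_cover G L' H'"
    unfolding two_fold_cover_def
  proof (intro conjI ballI allI impI)
    show "simple_graph H'" unfolding simple_graph_def
    proof (intro conjI ballI)
      show "finite (verts H')" using fin by (simp add: H'_def)
      fix e assume "e \<in> edges H'"
      then obtain d where d: "d \<in> edges H" "e = f ` d" by (auto simp: H'_def)
      show "e \<subseteq> verts H'" using Esub[OF d(1)] d(2) by (auto simp: H'_def)
      show "card e = 2"
        using Ecard[OF d(1)] card_image[OF inj_on_subset[OF f Esub[OF d(1)]]] d(2) by simp
    qed
    show "(\<Union>u\<in>verts G. L' u) = verts H'" unfolding L'_def H'_def part[symmetric] by (simp add: image_UN)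
    show "disjoint_family_on L' (verts G)"
      unfolding disjoint_family_on_def L'_def
    proof (intro ballI impI)
      fix u v assume uv: "u \<in> verts G" "v \<in> verts G" "u \<noteq> v"
      have "f ` (L u) \<inter> f ` (L v) = f ` (L u \<inter> L v)"
        using inj_on_image_Int[OF f Lsub Lsub] uv by simp
      then show "f ` (L u) \<inter> f ` (L v) = {}"
        using dis uv unfolding disjoint_family_on_def by simp
    qed
  next
    fix u assume u: "u \<in> verts G"
    show "card (L' u) = 2"
      using card_image[OF inj_on_subset[OF f Lsub[OF u]]] compl[OF u] by (simp add: L'_def)
    have "{x, y} \<in> edges H" if "x \<in> L u" "y \<in> L u" "x \<noteq> y" for x y
      using compl[OF u] Lsub[OF u] that unfolding complete_graph_def induced_def by auto
    then show "complete_graph (induced H' (L' u))"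
      using Lsub[OF u] mem2 unfolding complete_graph_def induced_def L'_def by (auto simp: subset_iff) metis
  next
    fix u v assume "u \<in> verts G" "v \<in> verts G" "u \<noteq> v" "edges_between H' (L' u) (L' v) \<noteq> {}"
    then show "{u, v} \<in> edges G" using cross eb by auto
  next
    fix u v assume e: "{u, v} \<in> edges G"
    then have uv: "u \<in> verts G" "v \<in> verts G" using G by (auto simp: simple_graph_def)
    show "disjoint (edges_between H' (L' u) (L' v))"
      unfolding eb[OF uv]
    proof (rule disjointI)
      fix a b assume "a \<in> (`) f ` edges_between H (L u) (L v)"
        "b \<in> (`) f ` edges_between H (L u) (L v)" and ab: "a \<noteq> b"
      then obtain c d where cd: "c \<in> edges_between H (L u) (L v)"
        "d \<in> edges_between H (L u) (L v)" "a = f ` c" "b = f ` d" by auto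
      then have "c \<inter> d = {}" using match[OF e] ab by (metis disjointD)
      moreover have "c \<subseteq> verts H" "d \<subseteq> verts H" using cd(1,2) ebsub Esub by blast+
      ultimately show "a \<inter> b = {}" using inj_on_image_Int[OF f, of c d] cd(3,4) by auto
    qed
  qed
  moreover have "poor_rich G L' (f \<circ> p) (f \<circ> r)"
    using pr by (auto simp: poor_rich_def L'_def)
  ultimately obtain \<psi> where \<psi>: "defective_coloring i j G L' H' (f \<circ> p) (f \<circ> r) \<psi>"
    using col unfolding DP_colorable_def by blast
  define \<phi> where "\<phi> = inv_into (verts H) f \<circ> \<psi>"
  have map: "\<phi> v \<in> L v \<and> \<psi> v = f (\<phi> v)" if v: "v \<in> verts G" for v
  proof -
    from \<psi> v obtain x where x: "x \<in> L v" "\<psi> v = f x"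
      by (auto simp: defective_coloring_def cover_map_def L'_def)
    moreover from x have "inv_into (verts H) f (\<psi> v) = x" using f Lsub[OF v] by auto
    ultimately show ?thesis by (simp add: \<phi>_def)
  qed
  define S where "S = \<phi> ` verts G"
  have im: "\<psi> ` verts G = f ` S" using map by (force simp: S_def)
  have S: "S \<subseteq> verts H" using map Lsub by (auto simp: S_def)
  have deg: "graph_degree (induced H' (f ` S)) (f x) = graph_degree (induced H S) x" if x: "x \<in> verts H" for x
  proof -
    have sub: "f ` e \<subseteq> f ` S \<longleftrightarrow> e \<subseteq> S" if "e \<in> edges H" for e
    proof
      assume h: "f ` e \<subseteq> f ` S"
      show "e \<subseteq> S"
      proof
        fix z assume z: "z \<in> e"
        have "z \<in> verts H" using Esub[OF that] z by auto
        then moreover have "f z \<in> f ` S" using h z by (meson imageI subsetD)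
        ultimately show "z \<in> S" using inj_on_image_mem_iff[OF f _ S] by simp
      qed
    qed auto
    have m: "f x \<in> f ` e \<longleftrightarrow> x \<in> e" if "e \<in> edges H" for e
      using inj_on_image_mem_iff[OF f x Esub[OF that]] .
    have "{e \<in> edges (induced H' (f ` S)). f x \<in> e} =
        {e \<in> (`) f ` edges H. e \<subseteq> f ` S \<and> f x \<in> e}"
      by (auto simp: induced_def H'_def)
    also have "\<dots> = (`) f ` {e \<in> edges H. f ` e \<subseteq> f ` S \<and> f x \<in> f ` e}"
      by blast
    also have "\<dots> = (`) f ` {e \<in> edges (induced H S). x \<in> e}"
      unfolding induced_def by (simp add: sub m cong: conj_cong)
    finally have "{e \<in> edges (induced H' (f ` S)). f x \<in> e} =
        (`) f ` {e \<in> edges (induced H S). x \<in> e}" .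
    moreover have "inj_on ((`) f) {e \<in> edges (induced H S). x \<in> e}"
      using Esub inj_on_image_eq_iff[OF f] by (auto simp: inj_on_def induced_def)
    ultimately show ?thesis by (simp add: graph_degree_def card_image)
  qed
  have bnd: "graph_degree (induced H S) x \<le> k"
    if all: "\<forall>y \<in> verts (induced H' (f ` S)) \<inter> (f \<circ> q) ` verts G.
      graph_degree (induced H' (f ` S)) y \<le> k"
      and x: "x \<in> verts (induced H S) \<inter> q ` verts G" for q k x
  proof -
    have "x \<in> verts H" "f x \<in> verts (induced H' (f ` S)) \<inter> (f \<circ> q) ` verts G"
      using x by (auto simp: induced_def H'_def)
    then show ?thesis using all deg by metis
  qed
  have "\<forall>y \<in> verts (induced H' (f ` S)) \<inter> (f \<circ> p) ` verts G.
      graph_degree (induced H' (f ` S)) y \<le> i"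
    "\<forall>y \<in> verts (induced H' (f ` S)) \<inter> (f \<circ> r) ` verts G.
      graph_degree (induced H' (f ` S)) y \<le> j"
    using \<psi> unfolding defective_coloring_def Let_def im by blast+
  from bnd[OF this(1)] bnd[OF this(2)] have "defective_coloring i j G L H p r \<phi>"
    using map unfolding defective_coloring_def cover_map_def Let_def S_def[symmetric] by blast
  then show ?thesis by blast
qed

definition DP_critical :: "nat \<Rightarrow> nat \<Rightarrow> 'v ugraph \<Rightarrow> bool" where
  "DP_critical i j G \<longleftrightarrow>
     simple_graph G \<and> \<not> DP_colorable i j G \<and>
     (\<forall>G'. proper_subgraph G' G \<longrightarrow> DP_colorable i j G')"

text \<open>The minimum is taken in \<open>enat\<close>: it is \<open>\<infinity>\<close> if there is no critical graph on \<open>n\<close> vertices.\<close>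

definition g_DP :: "nat \<Rightarrow> nat \<Rightarrow> nat \<Rightarrow> enat" where
  "g_DP i j n =
     (INF G \<in> {G :: nat ugraph. DP_critical i j G \<and> card (verts G) = n}. enat (card (edges G)))"

end

theory Submission
  imports Defs "HOL-Library.Nat_Bijection"
begin

text \<open>Put \<open>i + 1\<close> tokens on each edge and split them between its ends. If
  \<open>(i + 1) e(Q) \<le> (2 i + 1) |Q| + (j - i)\<close> for all vertex sets \<open>Q\<close>, this can be done so that the numbers of tokens
  exceed \<open>2 i + 1\<close> by at most \<open>j - i\<close> in total. A vertex with at most \<open>2 i + 1\<close> tokens holds all tokens of at
  most one edge, whose other end we call its parent. For an extremal splitting the parent relation is
  a forest and all vertices with more tokens are roots. Color every non-root so that it does not
  conflict with its parent: its other edges with tokens number at most \<open>i\<close>, so either color is safe. Roots with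
  at most \<open>j\<close> tokens may be rich. A root with more tokens has at most \<open>i + j + 1\<close>, hence
  one of its two colors is safe once its relevant neighbours are colored; this needs that
  these neighbours are not its own descendants, which holds in simple graphs.

  If \<open>G\<close> is critical and too sparse, take \<open>S\<close> maximizing \<open>(i + 1) e(S) - (2 i + 1) |S|\<close>. Either the condition
  above holds, or \<open>S\<close> is proper, \<open>G[S]\<close> is colorable, and by maximality the same argument, without excess,
  extends the coloring to \<open>G\<close> so that no edge leaving \<open>S\<close> is in conflict.

  For sharpness, the sparseness criterion makes the criticality of a tight example easy: it suffices
  that the example is not colorable and that all its proper vertex subsets satisfy the condition.\<close>

section \<open>Token assignments\<close>

text \<open>A smallest nonempty closed set works: its image is again nonempty and closed, hence not
  smaller. This supplies the cycle when the parent relation is not well-founded.\<close>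

lemma closed_bij_subset:
  fixes f :: "'v \<Rightarrow> 'v"
  assumes "finite Q" and "Q \<noteq> {}" and "f ` Q \<subseteq> Q"
  shows "\<exists>C\<subseteq>Q. C \<noteq> {} \<and> f ` C = C \<and> inj_on f C"
proof -
  let ?ok = "\<lambda>C. C \<subseteq> Q \<and> C \<noteq> {} \<and> f ` C \<subseteq> C"
  have "?ok Q" using assms by auto
  then obtain C where C: "?ok C" and min: "\<And>D. ?ok D \<Longrightarrow> card C \<le> card D"
    using ex_has_least_nat[of ?ok Q card] by blast
  have fC: "finite C" using C assms finite_subset by blast
  have "?ok (f ` C)" using C by blast
  then have "card C \<le> card (f ` C)" by (rule min)
  then have "f ` C = C" using C fC by (meson card_seteq)
  then show ?thesis using C fC eq_card_imp_inj_on[OF fC, of f] by auto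
qed

text \<open>Walking along \<open>g\<close> from \<open>w\<close> to its end \<open>v\<close> visits the set \<open>C\<close>. Only \<open>C\<close> and the injectivity of
  \<open>g\<close> on it matter for moving tokens, so paths and cycles are both treated as such sets.\<close>

lemma path_set:
  fixes g :: "'v \<Rightarrow> 'v" and N :: "'v set"
  defines "P \<equiv> {(g u, u) | u. u \<in> N}"
  assumes wf: "wf P" and "(v, w) \<in> P\<^sup>*" and v: "v \<notin> N" and "w \<in> N"
  shows "\<exists>C\<subseteq>N. finite C \<and> w \<in> C \<and> inj_on g C \<and> g ` C = insert v (C - {w}) \<and> (\<forall>u\<in>C. (u, w) \<in> P\<^sup>*)"
  using wf assms(3,5)
proof (induction w rule: wf_induct_rule)
  case (less w)
  have gw: "(g w, w) \<in> P" using less.prems by (auto simp: P_def)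
  have only: "y = g w" if "(y, w) \<in> P" for y using that by (auto simp: P_def)
  have "v \<noteq> w" using less.prems v by auto
  then have vg: "(v, g w) \<in> P\<^sup>*" using less.prems(1) only by (metis rtranclE)
  show ?case
  proof (cases "g w \<in> N")
    case False
    have "v = g w"
    proof (rule ccontr)
      assume "v \<noteq> g w"
      then obtain y where "(y, g w) \<in> P" using vg by (metis rtranclE)
      then show False using False by (auto simp: P_def)
    qed
    then show ?thesis using less.prems by (intro exI[of _ "{w}"]) auto
  next
    case True
    obtain C where C: "C \<subseteq> N" "finite C" "g w \<in> C" "inj_on g C" "g ` C = insert v (C - {g w})"
      "\<forall>u\<in>C. (u, g w) \<in> P\<^sup>*"
      using less.IH[OF gw vg True] by blast
    have "w \<notin> C"
    proof
      assume "w \<in> C"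
      then have "(w, w) \<in> P\<^sup>+" using C(6) gw by (meson rtrancl_into_trancl1)
      then show False using wf wf_acyclic by (auto simp: acyclic_def)
    qed
    moreover have "g w \<notin> g ` C" using C(5) v True by auto
    ultimately have "inj_on g (insert w C)" "g ` insert w C = insert v (insert w C - {w})"
      using C by auto
    moreover have "\<forall>u\<in>insert w C. (u, w) \<in> P\<^sup>*"
      using C(6) gw by (auto intro: rtrancl.rtrancl_into_rtrancl)
    ultimately show ?thesis using C less.prems by (intro exI[of _ "insert w C"]) auto
  qed
qed

locale token_graph =
  fixes V :: "'v set" and E :: "('v \<times> 'v) set" and m :: int
  assumes fin: "finite V" and E_sub: "E \<subseteq> V \<times> V"
    and E_sym: "(a, b) \<in> E \<Longrightarrow> (b, a) \<in> E" and E_irrefl: "(a, a) \<notin> E"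
    and m_ge: "m \<ge> 2"
begin

text \<open>A token assignment puts \<open>m\<close> tokens on every edge and splits them between its ends; \<open>x a b\<close> is the
  share of \<open>a\<close> in the edge \<open>ab\<close>.\<close>

definition valid :: "('v \<Rightarrow> 'v \<Rightarrow> int) \<Rightarrow> bool" where
  "valid x \<longleftrightarrow> (\<forall>(a, b)\<in>E. x a b + x b a = m \<and> 0 \<le> x a b)"

definition tok :: "('v \<Rightarrow> 'v \<Rightarrow> int) \<Rightarrow> 'v \<Rightarrow> int" where
  "tok x a = (\<Sum>b\<in>E `` {a}. x a b)"

text \<open>The relation points from a vertex to its parent: \<open>a\<close> holds all
  \<open>m\<close> tokens of the edge \<open>ab\<close>.\<close>

definition full :: "('v \<Rightarrow> 'v \<Rightarrow> int) \<Rightarrow> ('v \<times> 'v) set" where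
  "full x = {(a, b). (a, b) \<in> E \<and> x b a = 0}"

definition excess :: "('v \<Rightarrow> int) \<Rightarrow> ('v \<Rightarrow> 'v \<Rightarrow> int) \<Rightarrow> int" where
  "excess cap x = (\<Sum>a\<in>V. max 0 (tok x a - cap a))"

text \<open>Every \<open>a\<close> in \<open>C\<close> hands one token of its edge to
  \<open>g a\<close> over to \<open>g a\<close>. On a path set this moves one token from end to end;
  on a cycle it changes no total.\<close>

definition shift :: "('v \<Rightarrow> 'v) \<Rightarrow> 'v set \<Rightarrow> ('v \<Rightarrow> 'v \<Rightarrow> int) \<Rightarrow> 'v \<Rightarrow> 'v \<Rightarrow> int" where
  "shift g C x a b = x a b - of_bool (a \<in> C \<and> b = g a) + of_bool (b \<in> C \<and> a = g b)"

section \<open>Elementary token moves\<close>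

lemma finE: "finite E" using E_sub fin finite_subset by blast
lemma finI: "finite (E `` {a})" using finE by (rule finite_Image)
lemma finfull: "finite (full x)" by (rule finite_subset[OF _ finE]) (auto simp: full_def)

lemma validD:
  assumes "valid x" and "(a, b) \<in> E"
  shows "x a b + x b a = m \<and> 0 \<le> x a b \<and> 0 \<le> x b a"
proof -
  have *: "x c d + x d c = m \<and> 0 \<le> x c d" if "(c, d) \<in> E" for c d
    using assms(1) that unfolding valid_def by auto
  from *[OF assms(2)] *[OF E_sym[OF assms(2)]] show ?thesis by simp
qed

lemma valid_shift:
  assumes x: "valid x" and g: "\<And>a. a \<in> C \<Longrightarrow> (a, g a) \<in> E \<and> x a (g a) \<ge> 1"
  shows "valid (shift g C x)"
  unfolding valid_def
proof clarify
  fix a b assume e: "(a, b) \<in> E"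
  have "a \<in> C \<and> b = g a \<Longrightarrow> x a b \<ge> 1" using g by auto
  then show "shift g C x a b + shift g C x b a = m \<and> 0 \<le> shift g C x a b"
    using validD[OF x e] by (auto simp: shift_def of_bool_def)
qed

text \<open>By injectivity no vertex receives two tokens, so vertices that both give and receive
  keep their totals.\<close>

lemma tok_shift:
  assumes g: "\<And>a. a \<in> C \<Longrightarrow> (a, g a) \<in> E" and inj: "inj_on g C"
  shows "tok (shift g C x) a = tok x a - of_bool (a \<in> C) + of_bool (a \<in> g ` C)"
proof -
  have 1: "(\<Sum>b\<in>E `` {a}. of_bool (a \<in> C \<and> b = g a) :: int) = of_bool (a \<in> C)"
  proof (cases "a \<in> C")
    case True
    then have "g a \<in> E `` {a}" using g by auto
    then show ?thesis using True finI by (simp add: of_bool_def)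
  qed auto
  have 2: "(\<Sum>b\<in>E `` {a}. of_bool (b \<in> C \<and> a = g b) :: int) = of_bool (a \<in> g ` C)"
  proof (cases "a \<in> g ` C")
    case True
    then obtain c where c: "c \<in> C" "a = g c" by auto
    have "(b \<in> C \<and> a = g b) = (b = c)" for b using c inj by (auto simp: inj_on_def)
    moreover have "c \<in> E `` {a}" using g c E_sym by auto
    ultimately show ?thesis using True finI by (simp add: of_bool_def)
  qed (auto intro!: sum.neutral)
  show ?thesis unfolding tok_def shift_def sum.distrib sum_subtractf 1 2 by simp
qed

text \<open>An edge is full at \<open>c\<close> afterwards if the share of \<open>d\<close> was zero
  already or if \<open>d\<close> has just given its last token. Excluding 2-cycles of
  \<open>g\<close> prevents two moves on one edge from cancelling.\<close>

lemma full_shift: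
  assumes cd: "(c, d) \<in> full (shift g C x)" and x: "valid x"
    and no2: "\<And>a. a \<in> C \<Longrightarrow> g a \<in> C \<Longrightarrow> g (g a) \<noteq> a"
  shows "((c, d) \<in> full x \<and> \<not> (c \<in> C \<and> d = g c)) \<or> (d \<in> C \<and> c = g d \<and> x d c = 1)"
proof -
  have e: "(c, d) \<in> E" and z: "shift g C x d c = 0" using cd by (auto simp: full_def)
  show ?thesis
  proof (cases "d \<in> C \<and> c = g d")
    case True
    then have "\<not> (c \<in> C \<and> d = g c)" using no2[of d] by auto
    then have "of_bool (c \<in> C \<and> d = g c) = (0 :: int)" by simp
    then have "x d c = 1" using True z unfolding shift_def by (simp only: True) simp
    then show ?thesis using True by simp
  next
    case False
    then have "x d c + of_bool (c \<in> C \<and> d = g c) = 0" using z by (auto simp: shift_def)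
    moreover have "x d c \<ge> 0" using validD[OF x e] by simp
    ultimately show ?thesis using e by (cases "c \<in> C \<and> d = g c") (auto simp: full_def)
  qed
qed

lemma exists_valid: "\<exists>x. valid x"
proof -
  \<comment> \<open>The choice is made on the unordered pair, so both ends agree on who receives all
    \<open>m\<close> tokens.\<close>
  define s :: "'v set \<Rightarrow> 'v" where "s = (\<lambda>e. SOME z. z \<in> e)"
  define x :: "'v \<Rightarrow> 'v \<Rightarrow> int" where "x = (\<lambda>a b. if a = s {a, b} then m else 0)"
  have "x a b + x b a = m \<and> 0 \<le> x a b" if "(a, b) \<in> E" for a b
  proof -
    have "a \<noteq> b" using that E_irrefl by auto
    moreover have "s {a, b} \<in> {a, b}" unfolding s_def by (rule someI[of _ a]) simp
    moreover have "x a b = (if a = s {a, b} then m else 0)" "x b a = (if b = s {a, b} then m else 0)"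
      by (simp_all add: x_def insert_commute)
    ultimately show ?thesis using m_ge by (cases "a = s {a, b}") auto
  qed
  then show ?thesis unfolding valid_def by blast
qed

section \<open>Counting tokens inside a vertex set\<close>

lemma sum_inside:
  assumes x: "valid x" and Q: "Q \<subseteq> V"
  shows "2 * (\<Sum>a\<in>Q. \<Sum>b\<in>E `` {a} \<inter> Q. x a b) = m * int (card (E \<inter> Q \<times> Q))"
proof -
  have fQ: "finite Q" using Q fin finite_subset by auto
  let ?F = "E \<inter> Q \<times> Q"
  have fF: "finite ?F" using finE by auto
  let ?s = "\<Sum>a\<in>Q. \<Sum>b\<in>E `` {a} \<inter> Q. x a b"
  have "?s = (\<Sum>(a, b)\<in>(SIGMA a:Q. E `` {a} \<inter> Q). x a b)"
    by (subst sum.Sigma) (use fQ in auto)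
  also have "(SIGMA a:Q. E `` {a} \<inter> Q) = ?F" by auto
  finally have A: "?s = (\<Sum>(a, b)\<in>?F. x a b)" .
  \<comment> \<open>\<open>E\<close> contains both orders of every edge, hence the factor 2;
    swapping the order pairs the two shares of an edge, which add up to \<open>m\<close>.\<close>
  have B: "(\<Sum>(a, b)\<in>?F. x a b) = (\<Sum>(a, b)\<in>?F. x b a)"
    by (rule sum.reindex_bij_witness[of _ prod.swap prod.swap]) (auto dest: E_sym)
  have "2 * ?s = (\<Sum>(a, b)\<in>?F. x a b) + (\<Sum>(a, b)\<in>?F. x b a)"
    using A B by simp
  also have "\<dots> = (\<Sum>(a, b)\<in>?F. m)"
    unfolding sum.distrib[symmetric] by (intro sum.cong refl) (use validD[OF x] in auto)
  finally show ?thesis by simp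
qed

lemma sum_tok:
  assumes x: "valid x" and Q: "Q \<subseteq> V"
    and closed: "\<And>a b. a \<in> Q \<Longrightarrow> (a, b) \<in> E \<Longrightarrow> b \<notin> Q \<Longrightarrow> x a b = 0"
  shows "2 * (\<Sum>a\<in>Q. tok x a) = m * int (card (E \<inter> Q \<times> Q))"
proof -
  have "(\<Sum>a\<in>Q. tok x a) = (\<Sum>a\<in>Q. \<Sum>b\<in>E `` {a} \<inter> Q. x a b)"
    unfolding tok_def by (intro sum.cong refl sum.mono_neutral_right finI) (use closed in auto)
  then show ?thesis using sum_inside[OF x Q] by simp
qed

text \<open>Tokens on edges leaving \<open>Q\<close> count only on the right. One such token already
  gains 2, and this strictness later makes the tight example critical.\<close>

lemma sum_tok_ge:
  assumes x: "valid x" and Q: "Q \<subseteq> V"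
  shows "m * int (card (E \<inter> Q \<times> Q)) \<le> 2 * (\<Sum>a\<in>Q. tok x a)"
    and "a \<in> Q \<Longrightarrow> (a, b) \<in> E \<Longrightarrow> b \<notin> Q \<Longrightarrow> x a b \<ge> 1 \<Longrightarrow>
      m * int (card (E \<inter> Q \<times> Q)) + 2 \<le> 2 * (\<Sum>a\<in>Q. tok x a)"
proof -
  have fQ: "finite Q" using Q fin finite_subset by auto
  have pos: "0 \<le> x a b" if "b \<in> E `` {a}" for a b using validD[OF x, of a b] that by auto
  have le: "(\<Sum>b\<in>E `` {a} \<inter> Q. x a b) \<le> tok x a" for a
    unfolding tok_def by (rule sum_mono2[OF finI]) (use pos in auto)
  show "m * int (card (E \<inter> Q \<times> Q)) \<le> 2 * (\<Sum>a\<in>Q. tok x a)"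
    unfolding sum_inside[OF x Q, symmetric] using sum_mono[of Q, OF le] by simp
  assume ab: "a \<in> Q" "(a, b) \<in> E" "b \<notin> Q" "x a b \<ge> 1"
  have "(\<Sum>b\<in>insert b (E `` {a} \<inter> Q). x a b) \<le> tok x a"
    unfolding tok_def by (rule sum_mono2[OF finI]) (use pos ab in auto)
  then have "(\<Sum>b\<in>E `` {a} \<inter> Q. x a b) < tok x a" using ab finI by simp
  then have "(\<Sum>a\<in>Q. \<Sum>b\<in>E `` {a} \<inter> Q. x a b) < (\<Sum>a\<in>Q. tok x a)"
    using sum_strict_mono_ex1[OF fQ, of "\<lambda>a. \<Sum>b\<in>E `` {a} \<inter> Q. x a b" "tok x"] le ab(1) by blast
  then show "m * int (card (E \<inter> Q \<times> Q)) + 2 \<le> 2 * (\<Sum>a\<in>Q. tok x a)"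
    unfolding sum_inside[OF x Q, symmetric] by simp
qed

text \<open>The overload of \<open>u\<close> drops by one and that of \<open>v\<close> grows by at
  most one, and not at all if \<open>v\<close> was below its capacity.\<close>

lemma excess_move:
  assumes h: "\<And>a. tok y a = tok x a - of_bool (a = u) + of_bool (a = v)" and uv: "u \<in> V" "v \<in> V" "u \<noteq> v"
    and heavy: "tok x u > cap u"
  shows "excess cap y \<le> excess cap x" "tok x v < cap v \<Longrightarrow> excess cap y < excess cap x"
proof -
  have V: "V = insert u (insert v (V - {u, v}))" using uv by auto
  have s: "(\<Sum>a\<in>V. F a) = F u + F v + (\<Sum>a\<in>V - {u, v}. F a)" for F :: "'v \<Rightarrow> int"
    by (subst V) (use uv fin in simp)
  have r: "(\<Sum>a\<in>V - {u, v}. max 0 (tok y a - cap a)) = (\<Sum>a\<in>V - {u, v}. max 0 (tok x a - cap a))"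
    by (intro sum.cong refl) (use h in auto)
  have "tok y u = tok x u - 1" "tok y v = tok x v + 1" using h uv by auto
  then show "excess cap y \<le> excess cap x" "tok x v < cap v \<Longrightarrow> excess cap y < excess cap x"
    unfolding excess_def s r using heavy by auto
qed

text \<open>The deficiency version of Hakimi's orientation theorem, by augmenting paths.\<close>

lemma exists_low_excess:
  fixes cap :: "'v \<Rightarrow> int" and T :: int
  assumes dens: "\<And>Q. Q \<subseteq> V \<Longrightarrow> m * int (card (E \<inter> Q \<times> Q)) \<le> 2 * (\<Sum>a\<in>Q. cap a) + 2 * T"
  shows "\<exists>x. valid x \<and> excess cap x \<le> T"
proof -
  obtain x where x: "valid x" and min: "\<And>y. valid y \<Longrightarrow> nat (excess cap x) \<le> nat (excess cap y)"
    using exists_valid ex_has_least_nat[of valid _ "\<lambda>x. nat (excess cap x)"] by metis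
  have ex0: "excess cap y \<ge> 0" for y unfolding excess_def by (rule sum_nonneg) auto
  have min: "excess cap x \<le> excess cap y" if "valid y" for y using min[OF that] ex0 by (simp add: nat_le_eq_zle)
  \<comment> \<open>A token can be handed from \<open>a\<close> to \<open>b\<close> if
    \<open>(a, b)\<close> is in \<open>R\<close>. From the vertices of \<open>W\<close> a token can
    be passed on to a vertex below its capacity; \<open>g\<close> takes a step that brings such a
    vertex closer.\<close>
  define R where "R = {(a, b). (a, b) \<in> E \<and> x a b \<ge> 1}"
  define Light where "Light = {a \<in> V. tok x a < cap a}"
  define reach where "reach = (\<lambda>n a. \<exists>b\<in>Light. (a, b) \<in> R ^^ n)"
  define dist where "dist = (\<lambda>a. LEAST n. reach n a)"
  define W where "W = {a \<in> V. \<exists>n. reach n a}"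
  have step: "\<exists>b. (a, b) \<in> R \<and> b \<in> W \<and> dist b < dist a" if a: "a \<in> W" "a \<notin> Light" for a
  proof -
    have "reach (dist a) a" unfolding dist_def by (rule LeastI_ex) (use a in \<open>auto simp: W_def\<close>)
    moreover then obtain n where n: "dist a = Suc n" using a(2) by (cases "dist a") (auto simp: reach_def)
    ultimately obtain b c where bc: "(a, b) \<in> R" "(b, c) \<in> R ^^ n" "c \<in> Light"
      unfolding reach_def n by (meson relpow_Suc_E2)
    then have "reach n b" by (auto simp: reach_def)
    moreover then have "dist b \<le> n" unfolding dist_def by (rule Least_le)
    ultimately show ?thesis using bc n E_sub by (intro exI[of _ b]) (auto simp: W_def R_def)
  qed
  define g where "g = (\<lambda>a. SOME b. (a, b) \<in> R \<and> b \<in> W \<and> dist b < dist a)"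
  have g: "(a, g a) \<in> R \<and> g a \<in> W \<and> dist (g a) < dist a" if "a \<in> W - Light" for a
    unfolding g_def by (rule someI_ex) (use step that in auto)
  define N where "N = W - Light"
  let ?P = "{(g u, u) | u. u \<in> N}"
  have wf: "wf ?P" by (rule wf_subset[OF wf_measure[of dist]]) (use g in \<open>auto simp: N_def\<close>)
  \<comment> \<open>An overloaded vertex in \<open>W\<close> would start an augmenting path,
    contradicting minimality of the excess.\<close>
  have noheavy: "tok x u \<le> cap u" if u: "u \<in> W" for u
  proof (rule ccontr)
    assume h: "\<not> ?thesis"
    then have uN: "u \<in> N" using u by (auto simp: N_def Light_def)
    have "\<exists>v\<in>Light. (v, w) \<in> ?P\<^sup>*" if "w \<in> W" for w using that
    proof (induction "dist w" arbitrary: w rule: less_induct)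
      case less
      show ?case
      proof (cases "w \<in> Light")
        case False
        then have "w \<in> N" using less.prems by (simp add: N_def)
        then obtain v where "v \<in> Light" "(v, g w) \<in> ?P\<^sup>*" using less.hyps[of "g w"] g[of w] N_def by blast
        moreover have "(g w, w) \<in> ?P" using \<open>w \<in> N\<close> by auto
        ultimately show ?thesis by (meson rtrancl.rtrancl_into_rtrancl)
      qed auto
    qed
    then obtain v where v: "v \<in> Light" "(v, u) \<in> ?P\<^sup>*" using u by blast
    then obtain C where C: "C \<subseteq> N" "u \<in> C" "inj_on g C" "g ` C = insert v (C - {u})"
      using path_set[OF wf v(2) _ uN] by (auto simp: N_def)
    have gC: "(a, g a) \<in> E \<and> x a (g a) \<ge> 1" if "a \<in> C" for a using g[of a] that C(1) by (auto simp: N_def R_def)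
    let ?y = "shift g C x"
    have "v \<notin> C" using v C(1) by (auto simp: N_def)
    then have ty: "tok ?y a = tok x a - of_bool (a = u) + of_bool (a = v)" for a
      using tok_shift[OF _ C(3), of x a] gC C(2) by (auto simp: C(4) of_bool_def)
    have "excess cap ?y < excess cap x"
      by (rule excess_move(2)[OF ty]) (use u v h \<open>v \<notin> C\<close> C(2) in \<open>auto simp: W_def Light_def\<close>)
    moreover have "valid ?y" by (rule valid_shift[OF x gC])
    ultimately show False using min by fastforce
  qed
  define Q where "Q = V - W"
  have notLight: "tok x a \<ge> cap a" if "a \<in> Q" for a
  proof (rule ccontr)
    assume "\<not> ?thesis"
    then have "reach 0 a" using that by (auto simp: reach_def Light_def Q_def)
    then show False using that by (auto simp: Q_def W_def)
  qed
  have cl: "x a b = 0" if "a \<in> Q" "(a, b) \<in> E" "b \<notin> Q" for a b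
  proof (rule ccontr)
    assume "x a b \<noteq> 0"
    then have R: "(a, b) \<in> R" using validD[OF x that(2)] that(2) by (auto simp: R_def)
    have "b \<in> W" using that E_sub by (auto simp: Q_def)
    then obtain n where "reach n b" by (auto simp: W_def)
    then have "reach (Suc n) a" using R unfolding reach_def by (meson relpow_Suc_I2)
    then show False using that by (auto simp: Q_def W_def)
  qed
  have "excess cap x = (\<Sum>a\<in>Q. max 0 (tok x a - cap a))" unfolding excess_def
    by (intro sum.mono_neutral_right fin) (use noheavy in \<open>auto simp: Q_def\<close>)
  also have "\<dots> = (\<Sum>a\<in>Q. tok x a - cap a)" by (intro sum.cong refl) (use notLight in auto)
  also have "\<dots> = (\<Sum>a\<in>Q. tok x a) - (\<Sum>a\<in>Q. cap a)" by (rule sum_subtractf)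
  finally have ex: "excess cap x = (\<Sum>a\<in>Q. tok x a) - (\<Sum>a\<in>Q. cap a)" .
  have QV: "Q \<subseteq> V" by (auto simp: Q_def)
  have "excess cap x \<le> T" using ex sum_tok[OF x QV cl] dens[OF QV] by linarith
  then show ?thesis using x by blast
qed


section \<open>Extremal token assignments\<close>

definition sq_tok :: "('v \<Rightarrow> 'v \<Rightarrow> int) \<Rightarrow> int" where
  "sq_tok x = (\<Sum>a\<in>V. (tok x a)\<^sup>2)"

lemma tok_bounds:
  assumes x: "valid x"
  shows "0 \<le> tok x a" "tok x a \<le> m * int (card V)"
proof -
  have 1: "0 \<le> x a b \<and> x a b \<le> m" if "b \<in> E `` {a}" for b using validD[OF x, of a b] that by auto
  then show "0 \<le> tok x a" unfolding tok_def by (intro sum_nonneg) auto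
  have "tok x a \<le> (\<Sum>b\<in>E `` {a}. m)" unfolding tok_def by (rule sum_mono) (use 1 in auto)
  also have "\<dots> = m * int (card (E `` {a}))" by simp
  also have "\<dots> \<le> m * int (card V)"
    using card_mono[OF fin, of "E `` {a}"] E_sub m_ge by (intro mult_left_mono) auto
  finally show "tok x a \<le> m * int (card V)" .
qed

lemma sq_bound:
  assumes x: "valid x"
  shows "nat (sq_tok x) \<le> nat (\<Sum>a\<in>V. (m * int (card V))\<^sup>2)"
proof -
  have "(tok x a)\<^sup>2 \<le> (m * int (card V))\<^sup>2" for a
    using tok_bounds[OF x] by (intro power_mono)
  then show ?thesis unfolding sq_tok_def by (intro nat_mono sum_mono)
qed

lemma fullD:
  assumes "valid x" and "(a, b) \<in> full x"
  shows "(a, b) \<in> E" "x a b = m" "x b a = 0"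
proof -
  show "(a, b) \<in> E" "x b a = 0" using assms(2) by (auto simp: full_def)
  then show "x a b = m" using validD[OF assms(1), of a b] by simp
qed

text \<open>The choice is lexicographic: fewest full edges first, then the largest sum of squares.
  Assignments are arbitrary off \<open>E\<close>, so the maximum comes from the bound
  \<open>sq_bound\<close> and not from finiteness of the set of assignments.\<close>

lemma exists_optimal:
  assumes "\<exists>x. valid x \<and> excess cap x \<le> T"
  shows "\<exists>x. valid x \<and> excess cap x \<le> T \<and>
    (\<forall>y. valid y \<and> excess cap y \<le> T \<longrightarrow> card (full x) \<le> card (full y) \<and>
      (card (full y) = card (full x) \<longrightarrow> sq_tok y \<le> sq_tok x))"
proof -
  let ?ok = "\<lambda>x. valid x \<and> excess cap x \<le> T"
  obtain x0 where x0: "?ok x0" and min: "\<And>y. ?ok y \<Longrightarrow> card (full x0) \<le> card (full y)"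
    using assms ex_has_least_nat[of ?ok _ "\<lambda>x. card (full x)"] by metis
  let ?ok2 = "\<lambda>x. ?ok x \<and> card (full x) = card (full x0)"
  have "?ok2 x0" using x0 by simp
  moreover have "\<forall>y. ?ok2 y \<longrightarrow> nat (sq_tok y) < Suc (nat (\<Sum>a\<in>V. (m * int (card V))\<^sup>2))"
    using sq_bound by (simp add: less_Suc_eq_le)
  ultimately have "\<exists>x. ?ok2 x \<and> (\<forall>y. ?ok2 y \<longrightarrow> nat (sq_tok y) \<le> nat (sq_tok x))"
    by (rule ex_has_greatest_nat)
  then obtain x where x: "?ok2 x" and max: "\<And>y. ?ok2 y \<Longrightarrow> nat (sq_tok y) \<le> nat (sq_tok x)"
    by blast
  have "sq_tok y \<ge> 0" for y unfolding sq_tok_def by (rule sum_nonneg) auto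
  then have "sq_tok y \<le> sq_tok x" if "?ok2 y" for y using max[OF that] by (simp add: nat_le_eq_zle)
  then show ?thesis using x min by (intro exI[of _ x]) auto
qed

text \<open>The sum of squares changes by 2 (\<open>tok x v\<close> - \<open>tok x u\<close>) +
  2.\<close>

lemma sq_move:
  assumes h: "\<And>a. tok y a = tok x a - of_bool (a = u) + of_bool (a = v)" and uv: "u \<in> V" "v \<in> V" "u \<noteq> v"
    and le: "tok x u \<le> tok x v"
  shows "sq_tok y > sq_tok x"
proof -
  have V: "V = insert u (insert v (V - {u, v}))" using uv by auto
  have s: "(\<Sum>a\<in>V. F a) = F u + F v + (\<Sum>a\<in>V - {u, v}. F a)" for F :: "'v \<Rightarrow> int"
    by (subst V) (use uv fin in simp)
  have r: "(\<Sum>a\<in>V - {u, v}. (tok y a)\<^sup>2) = (\<Sum>a\<in>V - {u, v}. (tok x a)\<^sup>2)"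
    by (intro sum.cong refl) (use h in auto)
  have yu: "tok y u = tok x u - 1" and yv: "tok y v = tok x v + 1" using h uv by auto
  show ?thesis unfolding sq_tok_def s r yu yv using le by (simp add: power2_eq_square algebra_simps)
qed

text \<open>An assignment with fewest full edges, and among those with largest sum of squares, has the required
  properties: each violation is removed by moving one token along a full edge out of an overloaded
  vertex, around a cycle of full edges, or from \<open>v\<close> to \<open>w\<close> and then along full edges to \<open>v'\<close>.
  The last move loses all full edges on the path and creates at most one. It is harmless to gain one
  when the path has a single edge, since then \<open>v \<noteq> v'\<close> (there are no parallel edges) and the sum of
  squares grows.\<close>

lemma exists_good_tokens:
  fixes cap :: "'v \<Rightarrow> int"
  assumes ex: "\<exists>x. valid x \<and> excess cap x \<le> T" and cap: "\<And>a. a \<in> V \<Longrightarrow> cap a \<le> 2 * m - 1"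
  shows "\<exists>x. valid x \<and> excess cap x \<le> T \<and>
    (\<forall>a b. (a, b) \<in> full x \<longrightarrow> tok x a \<le> cap a) \<and>
    (\<forall>a b c. (a, b) \<in> full x \<and> (a, c) \<in> full x \<longrightarrow> b = c) \<and>
    wf ((full x)\<inverse>) \<and>
    (\<forall>v w v'. (v, w) \<in> E \<and> x v w \<ge> 1 \<and> cap v < tok x v \<and> cap v' < tok x v' \<and> tok x v \<le> tok x v' \<and>
      (v', w) \<in> ((full x)\<inverse>)\<^sup>* \<longrightarrow> w = v')"
proof -
  obtain x where x: "valid x" and xT: "excess cap x \<le> T"
    and opt: "\<And>y. valid y \<Longrightarrow> excess cap y \<le> T \<Longrightarrow> card (full x) \<le> card (full y)"
    and opt2: "\<And>y. valid y \<Longrightarrow> excess cap y \<le> T \<Longrightarrow> card (full y) = card (full x) \<Longrightarrow> sq_tok y \<le> sq_tok x"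
    using exists_optimal[OF ex] by blast
  note fullD = fullD[OF x]
  have no_improve: False if y: "valid y" "excess cap y \<le> T" "full y \<subset> full x" for y
    using opt[OF y(1,2)] psubset_card_mono[OF finfull y(3)] by simp
  have heavy: "tok x a \<le> cap a" if ab: "(a, b) \<in> full x" for a b
  proof (rule ccontr)
    assume h: "\<not> ?thesis"
    \<comment> \<open>After one token moves, both ends still hold a token since \<open>m\<close> is
      at least 2. The edge is then full in neither direction.\<close>
    let ?y = "shift (\<lambda>_. b) {a} x"
    have ne: "a \<noteq> b" using fullD(1)[OF ab] E_irrefl by auto
    have ty: "tok ?y c = tok x c - of_bool (c = a) + of_bool (c = b)" for c
      by (subst tok_shift) (use fullD(1)[OF ab] in auto)
    have "excess cap ?y \<le> excess cap x"
      by (rule excess_move(1)[OF ty]) (use fullD(1)[OF ab] E_sub ne h in auto)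
    moreover have "valid ?y" by (rule valid_shift[OF x]) (use fullD[OF ab] m_ge in auto)
    moreover have "full ?y \<subset> full x"
    proof -
      have "(c, d) \<in> full x - {(a, b)}" if "(c, d) \<in> full ?y" for c d
        using full_shift[OF that x] ne fullD(2)[OF ab] m_ge by auto
      then have "full ?y \<subseteq> full x - {(a, b)}" by auto
      then show ?thesis using ab by blast
    qed
    ultimately show False using no_improve xT by (meson order_trans)
  qed
  have uniq: "b = c" if b: "(a, b) \<in> full x" and c: "(a, c) \<in> full x" for a b c
  proof (rule ccontr)
    assume ne: "b \<noteq> c"
    \<comment> \<open>Two full edges would put at least \<open>2 * m\<close> tokens on
      \<open>a\<close>, while \<open>heavy\<close> and \<open>cap\<close> allow only
      \<open>2 * m - 1\<close>.\<close>
    have "(\<Sum>d\<in>{b, c}. x a d) \<le> tok x a" unfolding tok_def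
      by (intro sum_mono2 finI) (use fullD(1)[OF b] fullD(1)[OF c] validD[OF x] in auto)
    then have "2 * m \<le> tok x a" using ne fullD(2)[OF b] fullD(2)[OF c] by simp
    then show False using heavy[OF b] cap[of a] fullD(1)[OF b] E_sub by fastforce
  qed
  define f where "f = (\<lambda>a. THE b. (a, b) \<in> full x)"
  have f: "f a = b" if "(a, b) \<in> full x" for a b unfolding f_def using that uniq by (intro the_equality) auto
  define N where "N = Domain (full x)"
  have fN: "(a, f a) \<in> full x" if "a \<in> N" for a using that f by (auto simp: N_def)
  have P: "(full x)\<inverse> = {(f u, u) | u. u \<in> N}" using f by (auto simp: N_def)
  have no2: "f (f a) \<noteq> a" if "a \<in> N" "f a \<in> N" for a
    using fullD(2,3)[OF fN[OF that(1)]] fullD(2,3)[OF fN[OF that(2)]] m_ge by auto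
  have wf: "wf ((full x)\<inverse>)"
  proof (rule ccontr)
    assume "\<not> ?thesis"
    then obtain Q where Q: "Q \<noteq> {}" "\<forall>z\<in>Q. \<exists>y. (z, y) \<in> full x \<and> y \<in> Q"
      unfolding wf_eq_minimal by (metis converse_iff equals0D)
    have QN: "Q \<subseteq> N" and fQ: "f ` Q \<subseteq> Q" using Q f by (auto simp: N_def)
    have "finite N" using finfull by (auto simp: N_def finite_Domain)
    then have "finite Q" using QN finite_subset by blast
    then obtain C where C: "C \<subseteq> Q" "C \<noteq> {}" "f ` C = C" "inj_on f C"
      using closed_bij_subset[OF _ Q(1) fQ] by blast
    have CN: "C \<subseteq> N" using C QN by auto
    have fC: "(a, f a) \<in> E" "x a (f a) = m" if "a \<in> C" for a using fullD(1,2)[OF fN] that CN by auto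
    \<comment> \<open>Rotating one token around the cycle keeps all totals. Its edges stop being
      full, and since the giving ends keep \<open>m - 1\<close> tokens, none becomes full the other
      way.\<close>
    let ?y = "shift f C x"
    have "tok ?y a = tok x a" for a
      using tok_shift[OF fC(1) C(4), of x a] C(3) by simp
    then have "excess cap ?y \<le> T" using xT by (simp add: excess_def)
    moreover have "valid ?y" by (rule valid_shift[OF x]) (use fC m_ge in simp)
    moreover have "full ?y \<subset> full x"
    proof -
      have "(c, d) \<in> full x \<and> \<not> (c \<in> C \<and> d = f c)" if "(c, d) \<in> full ?y" for c d
      proof -
        have "\<not> (d \<in> C \<and> x d (f d) = 1)" using fC(2) m_ge by auto
        moreover have "f (f a) \<noteq> a" if "a \<in> C" "f a \<in> C" for a using no2 that CN by auto
        ultimately show ?thesis using full_shift[OF that x] by auto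
      qed
      moreover obtain c where "c \<in> C" using C by auto
      moreover then have "(c, f c) \<in> full x" using CN fN by auto
      ultimately show ?thesis by auto
    qed
    ultimately show False using no_improve by blast
  qed
  have desc: "w = v'" if vw: "(v, w) \<in> E" "x v w \<ge> 1" and hv: "cap v < tok x v" "cap v' < tok x v'"
    and le: "tok x v \<le> tok x v'" and anc: "(v', w) \<in> ((full x)\<inverse>)\<^sup>*" for v w v'
  proof (rule ccontr)
    assume ne: "w \<noteq> v'"
    have vN: "v \<notin> N" "v' \<notin> N" using heavy hv by (fastforce simp: N_def)+
    have wN: "w \<in> N" using anc ne by (auto simp: N_def elim: rtranclE)
    obtain C where C: "C \<subseteq> N" "finite C" "w \<in> C" "inj_on f C" "f ` C = insert v' (C - {w})"
      using path_set[of f N v' w] wf anc vN wN unfolding P by blast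
    have vC: "v \<notin> C" "v' \<notin> C" using C vN by auto
    \<comment> \<open>The moved token goes from \<open>v\<close> to \<open>w\<close> and then along
      parents through \<open>C\<close> to \<open>v'\<close>. If \<open>v = v'\<close>, this closes a
      cycle and the totals stay the same.\<close>
    define g where "g = f(v := w)"
    have g: "g v = w" "\<And>a. a \<in> C \<Longrightarrow> g a = f a" using vC by (auto simp: g_def)
    have nfw: "f a = v \<Longrightarrow> a \<in> C \<Longrightarrow> a \<noteq> w" for a using fullD(3)[OF fN, of a] C(1) vw by auto
    let ?D = "insert v C"
    let ?y = "shift g ?D x"
    have gC: "g ` C = insert v' (C - {w})" using C(5) g(2) by (metis image_cong)
    have gD: "g ` ?D = insert v' C" using gC g(1) C(3) by auto
    have "inj_on g C" using C(4) g(2) by (simp cong: inj_on_cong)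
    moreover have "g v \<notin> g ` (C - {v})" using gC g(1) ne by blast
    ultimately have injg: "inj_on g ?D" by (simp add: inj_on_insert)
    have ge: "(a, g a) \<in> E \<and> x a (g a) \<ge> 1" if "a \<in> ?D" for a
    proof (cases "a = v")
      case True
      then show ?thesis using vw g(1) by simp
    next
      case False
      then have "a \<in> C" using that by simp
      then show ?thesis using fullD(1,2)[OF fN, of a] g(2) C(1) m_ge by auto
    qed
    have ty: "tok ?y a = tok x a - of_bool (a = v) + of_bool (a = v')" for a
    proof -
      have "tok ?y a = tok x a - of_bool (a \<in> ?D) + of_bool (a \<in> insert v' C)"
        by (subst tok_shift[OF _ injg]) (use ge gD in simp_all)
      then show ?thesis using vC by (cases "a \<in> C") auto
    qed
    have vV: "v \<in> V" using vw E_sub by auto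
    have v'V: "v' \<in> V"
    proof -
      obtain a where "a \<in> C" "f a = v'" using C(5) by (metis imageE insertI1)
      then show ?thesis using fullD(1)[OF fN, of a] C(1) E_sub by auto
    qed
    have exc: "excess cap ?y \<le> T"
    proof (cases "v = v'")
      case True
      then show ?thesis using xT ty by (simp add: excess_def)
    next
      case False
      have "excess cap ?y \<le> excess cap x"
        by (rule excess_move(1)[where u = v and v = v']) (fact ty vV v'V False hv(1))+
      then show ?thesis using xT by simp
    qed
    have val: "valid ?y" by (rule valid_shift[OF x ge])
    have n2: "g (g a) \<noteq> a" if "a \<in> ?D" "g a \<in> ?D" for a
    proof (cases "a = v \<or> f a = v \<and> a \<noteq> v")
      case True
      then show ?thesis using g nfw C(3) that vC by (metis insert_iff)
    next
      case False
      then have "a \<in> C" "f a \<in> C" using that g by auto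
      then show ?thesis using g no2 C(1) by auto
    qed
    \<comment> \<open>All edges from \<open>C\<close> to parents lose fullness. Only
      \<open>vw\<close> can become full, at \<open>w\<close>, namely if \<open>v\<close> gave up its
      last token there.\<close>
    let ?A = "(\<lambda>a. (a, f a)) ` C"
    have sub: "full ?y \<subseteq> insert (w, v) (full x - ?A)"
    proof (rule subrelI)
      fix c d assume cd: "(c, d) \<in> full ?y"
      have "\<not> (d \<in> C \<and> x d (f d) = 1)" using fullD(2)[OF fN, of d] C(1) m_ge by auto
      then show "(c, d) \<in> insert (w, v) (full x - ?A)" using full_shift[OF cd x n2] g by auto
    qed
    have Asub: "?A \<subseteq> full x" using fN C(1) by auto
    have cA: "card ?A = card C" by (intro card_image) (auto simp: inj_on_def)
    have cle: "card (full ?y) \<le> 1 + (card (full x) - card C)"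
    proof -
      have "card (full ?y) \<le> card (insert (w, v) (full x - ?A))"
        by (rule card_mono[OF _ sub]) (use finfull in auto)
      also have "\<dots> \<le> 1 + card (full x - ?A)" by (simp add: card_insert_if finfull)
      also have "\<dots> = 1 + (card (full x) - card C)"
        using card_Diff_subset[OF _ Asub] C(2) cA by simp
      finally show ?thesis .
    qed
    have Cle: "card C \<le> card (full x)" using card_mono[OF finfull Asub] cA by simp
    have C1: "card C \<ge> 1" using C(2,3) by (metis One_nat_def Suc_leI card_gt_0_iff empty_iff)
    \<comment> \<open>Minimality leaves only a path with a single full edge, from \<open>w\<close>
      to its parent \<open>v'\<close>. Since \<open>v\<close> holds a token on \<open>vw\<close>,
      the parent of \<open>w\<close> is not \<open>v\<close>, hence \<open>v\<close> and
      \<open>v'\<close> differ.\<close>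
    have "card C = 1" using opt[OF val exc] cle Cle C1 by linarith
    then have Cw: "C = {w}" using C(3) by (metis card_1_singletonE singletonD)
    then have vv': "v \<noteq> v'" using C(5) nfw[of w] by auto
    have "sq_tok ?y > sq_tok x"
      by (rule sq_move[where u = v and v = v']) (fact ty vV v'V le vv')+
    moreover have "card (full ?y) = card (full x)" using opt[OF val exc] cle Cle C1 by linarith
    ultimately show False using opt2[OF val exc] by simp
  qed
  show ?thesis
    using x xT heavy uniq wf desc by (intro exI[of _ x] conjI allI impI) blast+
qed

end

section \<open>Coloring from tokens\<close>

text \<open>Here \<open>conf a c b d\<close> says that color \<open>c\<close> at \<open>a\<close> and color \<open>d\<close> at \<open>b\<close> are adjacent in the cover; \<open>True\<close> is rich.
  The vertices of \<open>S\<close> are already colored and carry no tokens, so every edge leaving \<open>S\<close> is full at its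
  outer end and causes no conflict.\<close>

lemma extend_coloring:
  fixes V S :: "'v set" and adj :: "'v \<Rightarrow> 'v \<Rightarrow> bool" and conf :: "'v \<Rightarrow> bool \<Rightarrow> 'v \<Rightarrow> bool \<Rightarrow> bool"
    and \<chi> :: "'v \<Rightarrow> bool" and i j T :: nat
  assumes fin: "finite V" and adjV: "\<And>a b. adj a b \<Longrightarrow> a \<in> V \<and> b \<in> V"
    and adj_sym: "\<And>a b. adj a b \<Longrightarrow> adj b a" and adj_irrefl: "\<And>a. \<not> adj a a"
    and conf_adj: "\<And>a c b d. conf a c b d \<Longrightarrow> adj a b"
    and conf_sym: "\<And>a c b d. conf a c b d \<Longrightarrow> conf b d a c"
    and match: "\<And>a b d. conf a True b d \<Longrightarrow> conf a False b d \<Longrightarrow> False"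
    and i: "i \<ge> 1" and j: "j \<ge> 2 * i + 1"
    and ST: "S = {} \<and> T = j - i \<or> T = 0" and SV: "S \<subseteq> V"
    and good0: "\<And>v. v \<in> S \<Longrightarrow> card {u \<in> S. conf v (\<chi> v) u (\<chi> u)} \<le> (if \<chi> v then j else i)"
    and dens: "\<And>Q. Q \<subseteq> V \<Longrightarrow>
      (i + 1) * card {(a, b). a \<in> Q \<and> b \<in> Q \<and> adj a b \<and> \<not> (a \<in> S \<and> b \<in> S)} \<le> 2 * ((2 * i + 1) * card (Q - S)) + 2 * T"
  shows "\<exists>\<phi>. \<forall>v\<in>V. card {u \<in> V. conf v (\<phi> v) u (\<phi> u)} \<le> (if \<phi> v then j else i)"
proof -
  define E where "E = {(a, b). adj a b \<and> \<not> (a \<in> S \<and> b \<in> S)}"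
  define m where "m = int i + 1"
  \<comment> \<open>Outside \<open>S\<close> the capacity is \<open>2 * m - 1\<close>, the largest
    value for which a vertex within capacity has at most one parent.\<close>
  define cap where "cap = (\<lambda>a. if a \<in> S then 0 else 2 * int i + 1)"
  interpret token_graph V E m
  proof unfold_locales
    show "E \<subseteq> V \<times> V" using adjV by (auto simp: E_def)
    show "(b, a) \<in> E" if "(a, b) \<in> E" for a b using that adj_sym by (auto simp: E_def)
  qed (use fin adj_irrefl i in \<open>auto simp: E_def m_def\<close>)
  have capsum: "(\<Sum>a\<in>Q. cap a) = (2 * int i + 1) * int (card (Q - S))" if "finite Q" for Q
  proof -
    have "(\<Sum>a\<in>Q. cap a) = (\<Sum>a\<in>Q - S. cap a)"
      by (intro sum.mono_neutral_right) (use that in \<open>auto simp: cap_def\<close>)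
    also have "\<dots> = (\<Sum>a\<in>Q - S. 2 * int i + 1)" by (intro sum.cong) (auto simp: cap_def)
    finally show ?thesis by simp
  qed
  have "\<exists>x. valid x \<and> excess cap x \<le> int T"
  proof (rule exists_low_excess)
    fix Q assume Q: "Q \<subseteq> V"
    have "{(a, b). a \<in> Q \<and> b \<in> Q \<and> adj a b \<and> \<not> (a \<in> S \<and> b \<in> S)} = E \<inter> Q \<times> Q" by (auto simp: E_def)
    then have "int ((i + 1) * card (E \<inter> Q \<times> Q)) \<le> int (2 * ((2 * i + 1) * card (Q - S)) + 2 * T)"
      using dens[OF Q] by (simp only: of_nat_le_iff)
    moreover have "finite Q" using Q fin finite_subset by blast
    ultimately show "m * int (card (E \<inter> Q \<times> Q)) \<le> 2 * (\<Sum>a\<in>Q. cap a) + 2 * int T"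
      using capsum[of Q] by (simp add: m_def algebra_simps)
  qed
  then obtain x where x: "valid x" and xT: "excess cap x \<le> int T"
    and light: "\<And>a b. (a, b) \<in> full x \<Longrightarrow> tok x a \<le> cap a"
    and uniq: "\<And>a b c. (a, b) \<in> full x \<Longrightarrow> (a, c) \<in> full x \<Longrightarrow> b = c"
    and wf: "wf ((full x)\<inverse>)"
    and desc: "\<And>v w v'. (v, w) \<in> E \<Longrightarrow> x v w \<ge> 1 \<Longrightarrow> cap v < tok x v \<Longrightarrow> cap v' < tok x v' \<Longrightarrow>
      tok x v \<le> tok x v' \<Longrightarrow> (v', w) \<in> ((full x)\<inverse>)\<^sup>* \<Longrightarrow> w = v'"
    using exists_good_tokens[of cap "int T"] by (fastforce simp: cap_def m_def)
  note fullD = fullD[OF x]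
  have each: "max 0 (tok x a - cap a) \<le> int T" if "a \<in> V" for a
  proof -
    have "max 0 (tok x a - cap a) \<le> excess cap x" unfolding excess_def
      by (rule member_le_sum) (use that fin in auto)
    then show ?thesis using xT by simp
  qed
  \<comment> \<open>If \<open>S\<close> is nonempty, then \<open>T = 0\<close>, so no vertex exceeds
    its capacity, which is 0 on \<open>S\<close>.\<close>
  have xS: "x s b = 0" if s: "s \<in> S" and e: "(s, b) \<in> E" for s b
  proof -
    have "tok x s \<le> 0" using each[of s] s SV ST by (auto simp: cap_def)
    moreover have "x s b \<le> tok x s" unfolding tok_def
      by (rule member_le_sum) (use e validD[OF x] finI in auto)
    ultimately show ?thesis using validD[OF x e] by simp
  qed
  define P where "P = (full x)\<inverse>"
  define N where "N = Domain (full x)"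
  \<comment> \<open>Bad vertices have too many tokens to be rich without further care. Loose edges
    have tokens at both ends and are the only ones where conflicts will be permitted;
    \<open>\<kappa> w\<close> is the largest number of tokens of a bad vertex from which
    \<open>w\<close> descends, or 0.\<close>
  define B where "B = {v \<in> V. tok x v > int j}"
  define loose where "loose = (\<lambda>v w. (v, w) \<in> E \<and> (v, w) \<notin> full x \<and> (w, v) \<notin> full x)"
  define \<kappa> where "\<kappa> = (\<lambda>w. Max (insert 0 ((\<lambda>v. nat (tok x v)) ` {v \<in> B. (v, w) \<in> P\<^sup>*})))"
  have fB: "finite B" using fin by (auto simp: B_def)
  have heavyB: "cap v < tok x v" if "v \<in> B" for v using that j i by (auto simp: B_def cap_def)
  have NB: "v \<notin> B" if "v \<in> N" for v using that light heavyB by (fastforce simp: N_def)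
  have SB: "v \<notin> B" "v \<notin> N" if "v \<in> S" for v
  proof -
    have "tok x v \<le> 0" using each[of v] that SV ST by (auto simp: cap_def)
    then show "v \<notin> B" by (auto simp: B_def)
    show "v \<notin> N" using fullD(1,2) xS[OF that] m_ge by (fastforce simp: N_def)
  qed
  have loose1: "x v w \<ge> 1" if "loose v w" for v w
    using that validD[OF x, of v w] E_sym[of v w] by (auto simp: loose_def full_def)
  have finA: "finite {v \<in> B. (v, w) \<in> P\<^sup>*}" for w using fB by auto
  define D where "D = P \<union> {(w, v). v \<in> B \<and> loose v w \<and> w \<notin> B}"
  have Psub: "\<kappa> b \<le> \<kappa> u" if "(b, u) \<in> P" for b u
    unfolding \<kappa>_def by (intro Max_mono insert_mono image_mono) (use finA that in auto)
  have Bsub: "\<kappa> w < \<kappa> v" if v: "v \<in> B" and l: "loose v w" and w: "w \<notin> B" for v w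
  proof -
    have "0 < tok x v" using v by (auto simp: B_def)
    moreover have "tok x v' < tok x v" if "v' \<in> B" "(v', w) \<in> P\<^sup>*" for v'
      using desc[of v w v'] loose1[OF l] l heavyB[OF v] heavyB[OF that(1)] that w
      by (fastforce simp: loose_def P_def)
    ultimately have "\<kappa> w < nat (tok x v)" unfolding \<kappa>_def
      by (subst Max_less_iff) (use finA in auto)
    also have "\<dots> \<le> \<kappa> v" unfolding \<kappa>_def by (rule Max_ge) (use finA v in auto)
    finally show ?thesis .
  qed
  have wfP: "wf P" using wf by (simp add: P_def)
  \<comment> \<open>Each vertex is colored after its parent, and a bad root after its loose neighbours that are not bad.
    The latter descend only from bad roots with fewer tokens, so there is no circular dependency.\<close>
  have "D \<subseteq> inv_image (less_than <*lex*> P) (\<lambda>v. (\<kappa> v, v))"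
  proof (rule subrelI)
    fix b u assume "(b, u) \<in> D"
    then consider "(b, u) \<in> P" | "u \<in> B" "loose u b" "b \<notin> B" by (auto simp: D_def)
    then show "(b, u) \<in> inv_image (less_than <*lex*> P) (\<lambda>v. (\<kappa> v, v))"
    proof cases
      case 1
      then show ?thesis using Psub[OF 1] by (auto simp: le_less)
    next
      case 2
      then show ?thesis using Bsub[OF 2] by simp
    qed
  qed
  then have wfD: "wf D"
    by (rule wf_subset[OF wf_inv_image[OF wf_lex_prod[OF wf_less_than wfP]]])
  define nb where "nb = (\<lambda>\<phi> v c. {w \<in> V - B. loose v w \<and> conf v c w (\<phi> w)})"
  \<comment> \<open>This depends on \<open>\<phi>\<close> only at vertices preceding
    \<open>v\<close> in \<open>D\<close>: the parent, or the loose neighbours of a bad root that are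
    not bad. Loose bad neighbours are counted whatever their color.\<close>
  define ok where "ok = (\<lambda>\<phi> v c. (v \<in> S \<longrightarrow> c = \<chi> v) \<and> (\<forall>b. (v, b) \<in> full x \<longrightarrow> \<not> conf v c b (\<phi> b)) \<and>
    (v \<in> B \<longrightarrow> card (nb \<phi> v c) + card {w \<in> B. loose v w} \<le> (if c then j else i)) \<and>
    (v \<notin> S \<and> v \<notin> N \<and> v \<notin> B \<longrightarrow> c))"
  \<comment> \<open>Every loose edge brings at least one token, and the edge to a parent brings
    \<open>m\<close> more.\<close>
  have loosecard: "int (card {w. loose v w}) \<le> tok x v"
    "v \<in> N \<Longrightarrow> int (card {w. loose v w}) + m \<le> tok x v" for v
  proof -
    let ?L = "{w. loose v w}"
    have sub: "?L \<subseteq> E `` {v}" by (auto simp: loose_def)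
    then have fL: "finite ?L" using finI finite_subset by blast
    have cL: "int (card ?L) \<le> (\<Sum>w\<in>?L. x v w)"
    proof -
      have "(\<Sum>w\<in>?L. 1) \<le> (\<Sum>w\<in>?L. x v w)" by (rule sum_mono) (use loose1 in auto)
      then show ?thesis by simp
    qed
    have "(\<Sum>w\<in>?L. x v w) \<le> tok x v" unfolding tok_def
      by (rule sum_mono2[OF finI sub]) (use validD[OF x] in auto)
    then show "int (card ?L) \<le> tok x v" using cL by simp
    assume "v \<in> N"
    then obtain b where b: "(v, b) \<in> full x" by (auto simp: N_def)
    then have bL: "b \<notin> ?L" by (auto simp: loose_def)
    have "(\<Sum>w\<in>insert b ?L. x v w) \<le> tok x v" unfolding tok_def
      by (rule sum_mono2[OF finI]) (use sub fullD(1)[OF b] validD[OF x] in auto)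
    then show "int (card ?L) + m \<le> tok x v" using cL bL fL fullD(2)[OF b] by simp
  qed
  have finL: "finite {w. loose v w}" for v
    by (rule finite_subset[OF _ finI[of v]]) (auto simp: loose_def)
  have exc: "\<exists>c. ok \<phi> v c" for \<phi> v
  proof -
    consider "v \<in> S" | "v \<in> N" | "v \<in> B" | "v \<notin> S" "v \<notin> N" "v \<notin> B" by blast
    then show ?thesis
    proof cases
      case 1
      then show ?thesis using SB[of v] by (intro exI[of _ "\<chi> v"]) (auto simp: ok_def N_def)
    next
      case 2
      then obtain b where b: "(v, b) \<in> full x" by (auto simp: N_def)
      obtain c where "\<not> conf v c b (\<phi> b)" using match[of v b "\<phi> b"] by blast
      then have "ok \<phi> v c" using 2 SB(2)[of v] NB[OF 2] uniq[OF b] by (auto simp: ok_def)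
      then show ?thesis ..
    next
      case 3
      have vS: "v \<notin> S" "v \<notin> N" using 3 SB NB by auto
      have vV: "v \<in> V" using 3 by (auto simp: B_def)
      have "T \<noteq> 0" using each[OF vV] heavyB[OF 3] by auto
      then have S: "S = {}" "T = j - i" using ST by auto
      let ?b = "card {w \<in> B. loose v w}"
      have Bsum: "(\<Sum>a\<in>B. max 0 (tok x a - cap a)) \<le> int (j - i)"
      proof -
        have "(\<Sum>a\<in>B. max 0 (tok x a - cap a)) \<le> excess cap x" unfolding excess_def
          by (rule sum_mono2[OF fin]) (auto simp: B_def)
        then show ?thesis using xT S by simp
      qed
      \<comment> \<open>Other bad vertices may be colored later. Each of them uses a unit of the excess, which pays for
        counting its edge to \<open>v\<close> as a conflict for both colors of \<open>v\<close>.\<close>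
      have "(\<Sum>a\<in>B - {v}. 1) \<le> (\<Sum>a\<in>B - {v}. max 0 (tok x a - cap a))"
        by (rule sum_mono) (use heavyB in fastforce)
      then have "int (card (B - {v})) + (tok x v - cap v) \<le> int (j - i)"
        using Bsum sum.remove[OF fB 3, of "\<lambda>a. max 0 (tok x a - cap a)"] by simp
      then have t: "tok x v + int (card (B - {v})) \<le> int (i + j + 1)" using S j by (simp add: cap_def)
      have bB: "?b \<le> card (B - {v})"
        by (rule card_mono) (use fB E_irrefl in \<open>auto simp: loose_def\<close>)
      have disj: "nb \<phi> v True \<inter> nb \<phi> v False = {}" using match by (auto simp: nb_def)
      have nbL: "nb \<phi> v c \<subseteq> {w. loose v w}" for c by (auto simp: nb_def)
      have fnb: "finite (nb \<phi> v c)" for c using nbL finL by (rule finite_subset)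
      have "card (nb \<phi> v True \<union> nb \<phi> v False \<union> {w \<in> B. loose v w}) \<le> card {w. loose v w}"
        by (rule card_mono[OF finL]) (auto simp: nb_def)
      moreover have "card (nb \<phi> v True \<union> nb \<phi> v False \<union> {w \<in> B. loose v w}) =
          card (nb \<phi> v True) + card (nb \<phi> v False) + ?b"
        by (subst card_Un_disjoint; (subst card_Un_disjoint)?)
          (use fnb fB disj in \<open>auto simp: nb_def\<close>)
      \<comment> \<open>Both colors together face at most \<open>i + j + 1\<close> conflicts, too
        few for \<open>j + 1\<close> on the rich and \<open>i + 1\<close> on the poor side.\<close>
      ultimately have "int (card (nb \<phi> v True) + card (nb \<phi> v False) + ?b + ?b) \<le> int (i + j + 1)"
        using loosecard(1)[of v] t bB by linarith
      then have "card (nb \<phi> v True) + ?b \<le> j \<or> card (nb \<phi> v False) + ?b \<le> i" by linarith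
      then show ?thesis
      proof
        assume "card (nb \<phi> v True) + ?b \<le> j"
        then have "ok \<phi> v True" using vS by (auto simp: ok_def N_def)
        then show ?thesis ..
      next
        assume "card (nb \<phi> v False) + ?b \<le> i"
        then have "ok \<phi> v False" using vS 3 by (auto simp: ok_def N_def)
        then show ?thesis ..
      qed
    next
      case 4
      then have "ok \<phi> v True" by (auto simp: ok_def N_def)
      then show ?thesis ..
    qed
  qed
  have "\<exists>\<phi>. \<forall>v. ok \<phi> v (\<phi> v)"
  proof (rule dependent_wf_choice[OF wfD])
    fix f g :: "'v \<Rightarrow> bool" and v c assume eq: "\<And>z. (z, v) \<in> D \<Longrightarrow> f z = g z"
    have "conf v c b (f b) = conf v c b (g b)" if "(v, b) \<in> full x" for b
      using eq[of b] that by (simp add: D_def P_def)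
    moreover have "v \<in> B \<Longrightarrow> nb f v c = nb g v c"
      using eq by (auto simp: nb_def D_def)
    ultimately show "ok f v c = ok g v c" unfolding ok_def by (metis (no_types, lifting))
  qed (rule exc)
  then obtain \<phi> where \<phi>: "\<And>v. ok \<phi> v (\<phi> v)" by blast
  show ?thesis
  proof (intro exI[of _ \<phi>] ballI)
    fix v assume v: "v \<in> V"
    let ?U = "{u \<in> V. conf v (\<phi> v) u (\<phi> u)}"
    have nf: "(v, u) \<notin> full x" "(u, v) \<notin> full x" if "u \<in> ?U" for u
    proof -
      have c: "conf v (\<phi> v) u (\<phi> u)" "conf u (\<phi> u) v (\<phi> v)" using that conf_sym by auto
      show "(v, u) \<notin> full x" using \<phi>[of v] c(1) unfolding ok_def by blast
      show "(u, v) \<notin> full x" using \<phi>[of u] c(2) unfolding ok_def by blast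
    qed
    show "card ?U \<le> (if \<phi> v then j else i)"
    proof (cases "v \<in> S")
      case True
      have "?U \<subseteq> {u \<in> S. conf v (\<chi> v) u (\<chi> u)}"
      proof
        fix u assume u: "u \<in> ?U"
        have "u \<in> S"
        proof (rule ccontr)
          assume "u \<notin> S"
          then have "(v, u) \<in> E" using u conf_adj by (auto simp: E_def)
          then have "(u, v) \<in> full x" using xS[OF True] E_sym by (auto simp: full_def)
          then show False using nf u by blast
        qed
        moreover then have "\<phi> u = \<chi> u" "\<phi> v = \<chi> v" using \<phi>[of u] \<phi>[of v] True by (auto simp: ok_def)
        ultimately show "u \<in> {u \<in> S. conf v (\<chi> v) u (\<chi> u)}" using u by simp
      qed
      then have "card ?U \<le> card {u \<in> S. conf v (\<chi> v) u (\<chi> u)}"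
        by (intro card_mono) (use finite_subset[OF SV fin] in auto)
      also have "\<dots> \<le> (if \<chi> v then j else i)" by (rule good0[OF True])
      also have "\<chi> v = \<phi> v" using \<phi>[of v] True by (simp add: ok_def)
      finally show ?thesis .
    next
      case False
      have UL: "?U \<subseteq> {w. loose v w}"
        using nf conf_adj False by (auto simp: loose_def E_def)
      have cU: "card ?U \<le> card {w. loose v w}" by (rule card_mono[OF finL UL])
      consider "v \<in> N" | "v \<in> B" | "v \<notin> N" "v \<notin> B" by blast
      then show ?thesis
      proof cases
        case 1
        \<comment> \<open>The edge to the parent takes \<open>i + 1\<close> of at most
          \<open>2 * i + 1\<close> tokens and leaves at most \<open>i\<close> loose edges.\<close>
        then have "tok x v \<le> 2 * int i + 1" using light[of v] False by (auto simp: N_def cap_def)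
        then have "card ?U \<le> i" using loosecard(2)[OF 1] cU by (simp add: m_def)
        then show ?thesis using j by auto
      next
        case 2
        have "?U \<subseteq> nb \<phi> v (\<phi> v) \<union> {w \<in> B. loose v w}" using UL by (auto simp: nb_def)
        then have "card ?U \<le> card (nb \<phi> v (\<phi> v) \<union> {w \<in> B. loose v w})"
          by (rule card_mono[rotated]) (use fin fB in \<open>auto simp: nb_def\<close>)
        also have "\<dots> \<le> card (nb \<phi> v (\<phi> v)) + card {w \<in> B. loose v w}" by (rule card_Un_le)
        also have "\<dots> \<le> (if \<phi> v then j else i)" using \<phi>[of v] 2 by (simp add: ok_def)
        finally show ?thesis .
      next
        case 3
        then have "\<phi> v" using \<phi>[of v] False by (simp add: ok_def)
        moreover have "card ?U \<le> j" using 3 v loosecard(1)[of v] cU by (auto simp: B_def)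
        ultimately show ?thesis by simp
      qed
    qed
  qed
qed

section \<open>Covers and the lower bound\<close>

definition cover_vertex :: "('v \<Rightarrow> 'h) \<Rightarrow> ('v \<Rightarrow> 'h) \<Rightarrow> 'v \<Rightarrow> bool \<Rightarrow> 'h" where
  "cover_vertex p r v c = (if c then r v else p v)"

text \<open>The condition on \<open>G\<close> sets aside the edge of \<open>H\<close> inside each
  list, whose ends are never chosen together.\<close>

definition conflict ::
  "'v ugraph \<Rightarrow> 'h ugraph \<Rightarrow> ('v \<Rightarrow> 'h) \<Rightarrow> ('v \<Rightarrow> 'h) \<Rightarrow> 'v \<Rightarrow> bool \<Rightarrow> 'v \<Rightarrow> bool \<Rightarrow> bool" where
  "conflict G H p r a c b d \<longleftrightarrow> {a, b} \<in> edges G \<and> {cover_vertex p r a c, cover_vertex p r b d} \<in> edges H"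

lemma card_ordered_pairs:
  assumes "finite F" and "\<And>e. e \<in> F \<Longrightarrow> card e = 2"
  shows "card {(a, b). {a, b} \<in> F} = 2 * card F"
proof -
  have "{(a, b). {a, b} \<in> F} = (\<Union>e\<in>F. {(a, b). {a, b} = e})" by auto
  also have "card \<dots> = (\<Sum>e\<in>F. card {(a, b). {a, b} = e})"
  proof (rule card_UN_disjoint[OF assms(1)])
    show "\<forall>e\<in>F. finite {(a, b). {a, b} = e}"
    proof
      fix e assume "e \<in> F"
      then have "finite e" using assms(2) card_ge_0_finite[of e] by simp
      moreover have "{(a, b). {a, b} = e} \<subseteq> e \<times> e" by auto
      ultimately show "finite {(a, b). {a, b} = e}" using finite_subset by blast
    qed
  qed auto
  also have "\<dots> = (\<Sum>e\<in>F. 2)"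
  proof (rule sum.cong[OF refl])
    fix e assume "e \<in> F"
    then obtain x y where xy: "e = {x, y}" "x \<noteq> y" using assms(2) by (metis card_2_iff)
    have "{(a, b). {a, b} = e} = {(x, y), (y, x)}" unfolding xy(1) by (auto simp: doubleton_eq_iff)
    then show "card {(a, b). {a, b} = e} = 2" using xy(2) by simp
  qed
  finally show ?thesis by simp
qed

definition edges_in :: "'v ugraph \<Rightarrow> 'v set \<Rightarrow> 'v set set" where
  "edges_in G Q = {e \<in> edges G. e \<subseteq> Q}"

lemma finite_edges: "simple_graph G \<Longrightarrow> finite (edges G)"
  unfolding simple_graph_def by (rule finite_subset[of _ "Pow (verts G)"]) auto

lemma edges_in_verts: "simple_graph G \<Longrightarrow> edges_in G (verts G) = edges G"
  by (auto simp: simple_graph_def edges_in_def)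

lemma simple_edge:
  assumes "simple_graph G" and "{a, b} \<in> edges G"
  shows "a \<in> verts G \<and> b \<in> verts G \<and> a \<noteq> b"
proof -
  have "{a, b} \<subseteq> verts G" "card {a, b} = 2" using assms unfolding simple_graph_def by blast+
  then show ?thesis by (cases "a = b") auto
qed

locale cover =
  fixes G :: "'v ugraph" and L :: "'v \<Rightarrow> 'h set" and H :: "'h ugraph" and p r :: "'v \<Rightarrow> 'h"
  assumes simple: "simple_graph G" and two_fold: "two_fold_cover G L H" and pr: "poor_rich G L p r"
begin

abbreviation "h \<equiv> cover_vertex p r"
abbreviation "conf \<equiv> conflict G H p r"

lemmas edgeG = simple_edge[OF simple]

lemma cross_edge:
  assumes "u \<in> verts G" "v \<in> verts G" "u \<noteq> v" and "e \<in> edges_between H (L u) (L v)"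
  shows "{u, v} \<in> edges G"
proof -
  have "edges_between H (L u) (L v) \<noteq> {}" using assms(4) by auto
  then show ?thesis using assms(1-3) two_fold by (auto simp: two_fold_cover_def)
qed

lemma Lh: "v \<in> verts G \<Longrightarrow> L v = range (h v)"
  using pr by (auto simp: poor_rich_def cover_vertex_def)

lemma h_eq: "a \<in> verts G \<Longrightarrow> b \<in> verts G \<Longrightarrow> h a c = h b d \<longleftrightarrow> a = b \<and> c = d"
proof -
  assume ab: "a \<in> verts G" "b \<in> verts G"
  have "a = b" if "h a c = h b d"
  proof (rule ccontr)
    assume "a \<noteq> b"
    then have "L a \<inter> L b = {}"
      using two_fold ab unfolding two_fold_cover_def disjoint_family_on_def by blast
    then show False using that Lh ab by (metis IntI empty_iff rangeI)
  qed
  moreover have "c = d" if "h a c = h a d"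
  proof (rule ccontr)
    assume "c \<noteq> d"
    then have "p a = r a" using that by (auto simp: cover_vertex_def split: if_splits)
    moreover have "card (L a) = 2" using two_fold ab unfolding two_fold_cover_def by blast
    ultimately show False using pr ab by (simp add: poor_rich_def)
  qed
  ultimately show ?thesis by auto
qed

lemma conf_sym: "conf a c b d \<Longrightarrow> conf b d a c"
  by (simp add: conflict_def insert_commute)

lemma conf_match:
  assumes "conf a True b d" and "conf a False b d"
  shows False
proof -
  have e: "{a, b} \<in> edges G" using assms by (simp add: conflict_def)
  then have ab: "a \<in> verts G" "b \<in> verts G" "a \<noteq> b" using edgeG by auto
  have "{h a c, h b d} \<in> edges_between H (L a) (L b)" for c
    using assms ab by (cases c) (auto intro!: edges_betweenI simp: Lh conflict_def)
  moreover have "disjoint (edges_between H (L a) (L b))"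
    using two_fold e unfolding two_fold_cover_def by blast
  moreover have "{h a True, h b d} \<noteq> {h a False, h b d}"
    using ab by (simp add: doubleton_eq_iff h_eq)
  ultimately show False by (meson disjointD disjoint_iff insertI1 insertI2)
qed

text \<open>Chosen vertices lie in different lists, so an edge between them projects to an edge of
  \<open>G\<close>. Degrees in the induced cover graph thus become numbers of conflicting
  neighbours.\<close>

lemma degree_conflicts:
  assumes S: "S \<subseteq> verts G" and v: "v \<in> S"
  shows "graph_degree (induced H ((\<lambda>v. h v (\<psi> v)) ` S)) (h v (\<psi> v)) = card {u \<in> S. conf v (\<psi> v) u (\<psi> u)}"
proof -
  let ?f = "\<lambda>v. h v (\<psi> v)"
  have vG: "v \<in> verts G" using S v by auto
  have "{e \<in> edges (induced H (?f ` S)). ?f v \<in> e} = (\<lambda>u. {?f v, ?f u}) ` {u \<in> S. conf v (\<psi> v) u (\<psi> u)}"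
  proof (intro equalityI subsetI)
    fix e assume "e \<in> {e \<in> edges (induced H (?f ` S)). ?f v \<in> e}"
    then have e: "e \<in> edges H" "e \<subseteq> ?f ` S" "?f v \<in> e" by (auto simp: induced_def)
    have "card e = 2" using e(1) two_fold by (auto simp: two_fold_cover_def simple_graph_def)
    then obtain a b where ab: "e = {a, b}" "a \<noteq> b" by (auto simp: card_2_iff)
    obtain y where y: "e = {?f v, y}" "y \<noteq> ?f v"
    proof (cases "?f v = a")
      case True
      then show ?thesis using that[of b] ab by simp
    next
      case False
      then have "?f v = b" using e(3) ab(1) by simp
      then show ?thesis using that[of a] ab by (simp add: insert_commute)
    qed
    then obtain u where u: "u \<in> S" "y = ?f u" using e(2) by auto
    have uG: "u \<in> verts G" "u \<noteq> v" using u S y(2) by auto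
    have "{?f v, ?f u} \<in> edges_between H (L v) (L u)"
    proof (rule edges_betweenI)
      show "?f v \<in> L v" "?f u \<in> L u" using Lh vG uG(1) by auto
      show "{?f v, ?f u} \<in> edges H" using e(1) y(1) u(2) by simp
    qed
    then have "{v, u} \<in> edges G" using cross_edge vG uG by metis
    then show "e \<in> (\<lambda>u. {?f v, ?f u}) ` {u \<in> S. conf v (\<psi> v) u (\<psi> u)}"
      using u e(1) y(1) by (intro image_eqI[of _ _ u]) (simp_all add: conflict_def)
  next
    fix e assume "e \<in> (\<lambda>u. {?f v, ?f u}) ` {u \<in> S. conf v (\<psi> v) u (\<psi> u)}"
    then show "e \<in> {e \<in> edges (induced H (?f ` S)). ?f v \<in> e}"
      using v by (auto simp: induced_def conflict_def)
  qed
  moreover have "inj_on (\<lambda>u. {?f v, ?f u}) {u \<in> S. conf v (\<psi> v) u (\<psi> u)}"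
  proof (rule inj_onI)
    fix a b assume a: "a \<in> {u \<in> S. conf v (\<psi> v) u (\<psi> u)}" and b: "b \<in> {u \<in> S. conf v (\<psi> v) u (\<psi> u)}"
      and eq: "{?f v, ?f a} = {?f v, ?f b}"
    have "?f a = ?f b" using eq by (auto simp: doubleton_eq_iff)
    then show "a = b" using a b S h_eq[of a b] by auto
  qed
  ultimately show ?thesis unfolding graph_degree_def by (simp add: card_image)
qed

lemma colorable_iff:
  "(\<exists>\<phi>. defective_coloring i j G L H p r \<phi>) \<longleftrightarrow>
    (\<exists>\<psi>. \<forall>v\<in>verts G. card {u \<in> verts G. conf v (\<psi> v) u (\<psi> u)} \<le> (if \<psi> v then j else i))"
    (is "?A \<longleftrightarrow> ?B")
proof
  assume ?A
  then obtain \<phi> where \<phi>: "defective_coloring i j G L H p r \<phi>" ..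
  define \<psi> where "\<psi> = (\<lambda>v. \<phi> v = r v)"
  have eq: "\<phi> v = h v (\<psi> v)" if "v \<in> verts G" for v
    using \<phi> that pr by (auto simp: \<psi>_def cover_vertex_def defective_coloring_def cover_map_def poor_rich_def)
  then have im: "\<phi> ` verts G = (\<lambda>v. h v (\<psi> v)) ` verts G" by (rule image_cong[OF refl])
  have "card {u \<in> verts G. conf v (\<psi> v) u (\<psi> u)} \<le> (if \<psi> v then j else i)" if v: "v \<in> verts G" for v
  proof -
    have "h v (\<psi> v) \<in> verts (induced H (\<phi> ` verts G))"
    proof -
      have "h v (\<psi> v) \<in> verts H" using two_fold v Lh[OF v] unfolding two_fold_cover_def by blast
      then show ?thesis using v eq by (auto simp: induced_def)
    qed
    moreover have "h v (\<psi> v) \<in> (if \<psi> v then r ` verts G else p ` verts G)" using v by (auto simp: cover_vertex_def)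
    ultimately have "graph_degree (induced H (\<phi> ` verts G)) (h v (\<psi> v)) \<le> (if \<psi> v then j else i)"
      using \<phi> by (auto simp: defective_coloring_def Let_def split: if_splits)
    then show ?thesis unfolding im using degree_conflicts[OF subset_refl v] by simp
  qed
  then show ?B by blast
next
  assume ?B
  then obtain \<psi> where \<psi>: "\<And>v. v \<in> verts G \<Longrightarrow>
    card {u \<in> verts G. conf v (\<psi> v) u (\<psi> u)} \<le> (if \<psi> v then j else i)" by blast
  let ?f = "\<lambda>v. h v (\<psi> v)"
  have "cover_map G L ?f" using Lh by (auto simp: cover_map_def)
  moreover have "graph_degree (induced H (?f ` verts G)) x \<le> (if c then j else i)"
    if x: "x \<in> verts (induced H (?f ` verts G))" "x \<in> (\<lambda>v. h v c) ` verts G" for x c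
  proof -
    obtain v where v: "v \<in> verts G" "x = ?f v" using x by (auto simp: induced_def)
    have "\<psi> v = c" using x(2) v h_eq[of v] by auto
    have "graph_degree (induced H (?f ` verts G)) (?f v) \<le> (if \<psi> v then j else i)"
      unfolding degree_conflicts[OF subset_refl v(1)] by (rule \<psi>[OF v(1)])
    then show ?thesis using v(2) \<open>\<psi> v = c\<close> by simp
  qed
  from this[where c = False] this[where c = True]
  have "\<forall>x \<in> verts (induced H (?f ` verts G)) \<inter> p ` verts G. graph_degree (induced H (?f ` verts G)) x \<le> i"
    "\<forall>x \<in> verts (induced H (?f ` verts G)) \<inter> r ` verts G. graph_degree (induced H (?f ` verts G)) x \<le> j"
    by (auto simp: cover_vertex_def)
  ultimately show ?A unfolding defective_coloring_def Let_def by blast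
qed

section \<open>Restriction and extension of colorings\<close>

lemma restrict_cover:
  assumes S: "S \<subseteq> verts G"
  shows "cover (induced G S) L (induced H (\<Union>u\<in>S. L u)) p r"
proof
  let ?H = "induced H (\<Union>u\<in>S. L u)"
  have vS: "verts (induced G S) = S" using S by (auto simp: induced_def)
  have eb: "edges_between ?H (L u) (L v) \<subseteq> edges_between H (L u) (L v)" for u v
    by (auto simp: edges_between_def induced_def)
  have LH: "L u \<subseteq> verts H" if "u \<in> S" for u
    using that S two_fold unfolding two_fold_cover_def by blast
  show "simple_graph (induced G S)" using simple by (auto simp: simple_graph_def induced_def)
  show "poor_rich (induced G S) L p r" using pr S by (auto simp: poor_rich_def vS)
  show "two_fold_cover (induced G S) L ?H"
    unfolding two_fold_cover_def vS
  proof (intro conjI ballI allI impI)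
    show "simple_graph ?H" using two_fold by (auto simp: two_fold_cover_def simple_graph_def induced_def)
    show "(\<Union>u\<in>S. L u) = verts ?H" using LH by (auto simp: induced_def)
    show "disjoint_family_on L S"
      using two_fold S unfolding two_fold_cover_def by (meson disjoint_family_on_mono)
    fix u assume u: "u \<in> S"
    show "card (L u) = 2" using two_fold u S unfolding two_fold_cover_def by blast
    have "complete_graph (induced H (L u))" using two_fold u S unfolding two_fold_cover_def by blast
    then show "complete_graph (induced ?H (L u))" using u
      by (auto simp: complete_graph_def induced_def)
  next
    fix u v assume uv: "u \<in> S" "v \<in> S" "u \<noteq> v" "edges_between ?H (L u) (L v) \<noteq> {}"
    have "edges_between H (L u) (L v) \<noteq> {}" using uv(4) eb by blast
    then have "{u, v} \<in> edges G" using uv S two_fold unfolding two_fold_cover_def by blast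
    then show "{u, v} \<in> edges (induced G S)" using uv by (auto simp: induced_def)
  next
    fix u v assume "{u, v} \<in> edges (induced G S)"
    then have "disjoint (edges_between H (L u) (L v))"
      using two_fold unfolding two_fold_cover_def induced_def by simp
    then show "disjoint (edges_between ?H (L u) (L v))" using eb by (meson pairwise_subset)
  qed
qed

lemma restrict_conflict:
  assumes S: "S \<subseteq> verts G" and ab: "a \<in> S" "b \<in> S"
  shows "conflict (induced G S) (induced H (\<Union>u\<in>S. L u)) p r a c b d \<longleftrightarrow> conf a c b d"
proof -
  have "a \<in> verts G" "b \<in> verts G" using S ab by auto
  then have "h a c \<in> L a" "h b d \<in> L b" using Lh by auto
  then show ?thesis using ab by (auto simp: conflict_def induced_def)
qed

lemma extend_defective_coloring:
  assumes i: "i \<ge> 1" and j: "j \<ge> 2 * i + 1" and ST: "S = {} \<and> T = j - i \<or> T = 0" and SV: "S \<subseteq> verts G"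
    and good: "\<And>v. v \<in> S \<Longrightarrow> card {u \<in> S. conf v (\<psi> v) u (\<psi> u)} \<le> (if \<psi> v then j else i)"
    and dens: "\<And>Q. Q \<subseteq> verts G \<Longrightarrow>
      (i + 1) * card (edges_in G (S \<union> Q) - edges_in G S) \<le> (2 * i + 1) * card (Q - S) + T"
  shows "\<exists>\<phi>. defective_coloring i j G L H p r \<phi>"
  unfolding colorable_iff
proof (rule extend_coloring[where conf = conf and S = S and T = T and adj = "\<lambda>a b. {a, b} \<in> edges G" and \<chi> = \<psi>])
  show fin: "finite (verts G)" using simple by (simp add: simple_graph_def)
  show "a \<in> verts G \<and> b \<in> verts G" if "{a, b} \<in> edges G" for a b using edgeG[OF that] by simp
  show "{a, b} \<in> edges G" if "conf a c b d" for a c b d using that by (simp add: conflict_def)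
  show "{b, a} \<in> edges G" if "{a, b} \<in> edges G" for a b using that by (simp add: insert_commute)
  show "{a, a} \<notin> edges G" for a using edgeG by blast
  show False if "conf a True b d" "conf a False b d" for a b d using that by (rule conf_match)
  fix Q assume Q: "Q \<subseteq> verts G"
  let ?F = "edges_in G (S \<union> Q) - edges_in G S"
  have fF: "finite (edges_in G X)" for X using finite_edges[OF simple] by (simp add: edges_in_def)
  \<comment> \<open>The hypothesis counts unordered edges and \<open>extend_coloring\<close> ordered
    pairs, so both sides double.\<close>
  have "{(a, b). a \<in> Q \<and> b \<in> Q \<and> {a, b} \<in> edges G \<and> \<not> (a \<in> S \<and> b \<in> S)} \<subseteq> {(a, b). {a, b} \<in> ?F}"
    by (auto simp: edges_in_def)
  moreover have "finite {(a, b). {a, b} \<in> ?F}"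
    by (rule finite_subset[of _ "verts G \<times> verts G"]) (use edgeG fin in \<open>auto simp: edges_in_def\<close>)
  ultimately have "card {(a, b). a \<in> Q \<and> b \<in> Q \<and> {a, b} \<in> edges G \<and> \<not> (a \<in> S \<and> b \<in> S)} \<le> card {(a, b). {a, b} \<in> ?F}"
    by (rule card_mono[rotated])
  also have "\<dots> = 2 * card ?F"
    by (rule card_ordered_pairs) (use simple fF in \<open>auto simp: edges_in_def simple_graph_def\<close>)
  finally have "(i + 1) * card {(a, b). a \<in> Q \<and> b \<in> Q \<and> {a, b} \<in> edges G \<and> \<not> (a \<in> S \<and> b \<in> S)} \<le>
      (i + 1) * (2 * card ?F)" by (rule mult_le_mono2)
  then show "(i + 1) * card {(a, b). a \<in> Q \<and> b \<in> Q \<and> {a, b} \<in> edges G \<and> \<not> (a \<in> S \<and> b \<in> S)}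
      \<le> 2 * ((2 * i + 1) * card (Q - S)) + 2 * T" using dens[OF Q] by simp
qed (fact i j ST SV good conf_sym)+

end

section \<open>Sparse graphs are colorable; critical graphs are dense\<close>

lemma colorable_if_sparse:
  assumes G: "simple_graph G" and i: "i \<ge> 1" and j: "j \<ge> 2 * i + 1"
    and sparse: "\<And>Q. Q \<subseteq> verts G \<Longrightarrow> (i + 1) * card (edges_in G Q) \<le> (2 * i + 1) * card Q + (j - i)"
  shows "DP_colorable i j G"
  unfolding DP_colorable_def
proof (intro allI impI, elim conjE)
  fix L :: "'a \<Rightarrow> nat set" and H p r assume c: "two_fold_cover G L H" "poor_rich G L p r"
  interpret cover G L H p r by unfold_locales (fact G c)+
  have "card (edges_in G ({} \<union> Q) - edges_in G {}) = card (edges_in G Q)" for Q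
  proof -
    have "edges_in G {} = {}" using G by (auto simp: edges_in_def simple_graph_def)
    then show ?thesis by simp
  qed
  then show "\<exists>\<phi>. defective_coloring i j G L H p r \<phi>"
    by (intro extend_defective_coloring[where S = "{}" and T = "j - i"]) (use i j sparse in auto)
qed

lemma critical_edges:
  assumes crit: "DP_critical i j G" and i: "i \<ge> 1" and j: "j \<ge> 2 * i + 1"
  shows "(i + 1) * card (edges G) > (2 * i + 1) * card (verts G) + (j - i)"
proof (rule ccontr)
  assume neg: "\<not> ?thesis"
  have G: "simple_graph G" and nc: "\<not> DP_colorable i j G"
    and sub: "\<And>G'. proper_subgraph G' G \<Longrightarrow> DP_colorable i j G'"
    using crit by (auto simp: DP_critical_def)
  have fin: "finite (verts G)" using G by (simp add: simple_graph_def)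
  define f where "f = (\<lambda>Q. int ((i + 1) * card (edges_in G Q)) - int ((2 * i + 1) * card Q))"
  obtain S where S: "S \<in> Pow (verts G)" and max: "\<And>Q. Q \<in> Pow (verts G) \<Longrightarrow> f Q \<le> f S"
  proof -
    have "finite (Pow (verts G))" "Pow (verts G) \<noteq> {}" using fin by auto
    then have "Max (f ` Pow (verts G)) \<in> f ` Pow (verts G)" by (intro Max_in) auto
    then show ?thesis using that Max_ge[of "f ` Pow (verts G)"] fin by fastforce
  qed
  have SV: "S \<subseteq> verts G" using S by simp
  have fG: "f (verts G) \<le> int (j - i)" using neg 
  proof -
    have "int ((i + 1) * card (edges G)) \<le> int ((2 * i + 1) * card (verts G) + (j - i))"
      using neg by (simp only: of_nat_le_iff not_less)
    then show ?thesis unfolding f_def edges_in_verts[OF G] by linarith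
  qed
  have fS: "f S > int (j - i)"
  proof (rule ccontr)
    assume fS: "\<not> ?thesis"
    have "(i + 1) * card (edges_in G Q) \<le> (2 * i + 1) * card Q + (j - i)" if "Q \<subseteq> verts G" for Q
    proof -
      have "f Q \<le> int (j - i)" using max[of Q] that fS by simp
      then have "int ((i + 1) * card (edges_in G Q)) \<le> int ((2 * i + 1) * card Q + (j - i))"
        unfolding f_def by linarith
      then show ?thesis by (simp only: of_nat_le_iff)
    qed
    then show False using colorable_if_sparse[OF G i j] nc by blast
  qed
  \<comment> \<open>The whole vertex set has potential at most \<open>j - i\<close> and
    \<open>S\<close> has more, so \<open>G[S]\<close> is a proper subgraph and colorable by
    criticality.\<close>
  have "S \<noteq> verts G" using fS fG by auto
  moreover have vS: "verts (induced G S) = S" using SV by (auto simp: induced_def)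
  ultimately have "induced G S \<noteq> G" by metis
  then have "proper_subgraph (induced G S) G"
    using G by (auto simp: proper_subgraph_def induced_def simple_graph_def)
  then have colS: "DP_colorable i j (induced G S)" by (rule sub)
  have "DP_colorable i j G"
    unfolding DP_colorable_def
  proof (intro allI impI, elim conjE)
    fix L :: "'a \<Rightarrow> nat set" and H p r assume c: "two_fold_cover G L H" "poor_rich G L p r"
    interpret cover G L H p r by unfold_locales (fact G c)+
    interpret S: cover "induced G S" L "induced H (\<Union>u\<in>S. L u)" p r by (rule restrict_cover[OF SV])
    have "\<exists>\<phi>. defective_coloring i j (induced G S) L (induced H (\<Union>u\<in>S. L u)) p r \<phi>"
      using colS S.two_fold S.pr unfolding DP_colorable_def by blast
    then obtain \<psi> where "\<forall>v\<in>S. card {u \<in> S. conflict (induced G S) (induced H (\<Union>u\<in>S. L u)) p r v (\<psi> v) u (\<psi> u)}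
        \<le> (if \<psi> v then j else i)"
      unfolding S.colorable_iff vS by blast
    moreover have "{u \<in> S. conflict (induced G S) (induced H (\<Union>u\<in>S. L u)) p r v (\<psi> v) u (\<psi> u)} =
        {u \<in> S. conf v (\<psi> v) u (\<psi> u)}" if "v \<in> S" for v
      using restrict_conflict[OF SV that] by blast
    ultimately have \<psi>: "card {u \<in> S. conf v (\<psi> v) u (\<psi> u)} \<le> (if \<psi> v then j else i)" if "v \<in> S" for v
      using that by simp
    show "\<exists>\<phi>. defective_coloring i j G L H p r \<phi>"
    proof (rule extend_defective_coloring[OF i j _ SV \<psi>, where T = 0])
      fix Q assume Q: "Q \<subseteq> verts G"
      let ?F = "edges_in G (S \<union> Q) - edges_in G S"
      have fF: "finite (edges_in G X)" for X using finite_edges[OF G] by (simp add: edges_in_def)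
      have sub: "edges_in G S \<subseteq> edges_in G (S \<union> Q)" by (auto simp: edges_in_def)
      have 2: "card (edges_in G (S \<union> Q)) = card (edges_in G S) + card ?F"
        using card_Diff_subset[OF fF sub] card_mono[OF fF sub] by simp
      have "card (S \<union> Q) = card (S \<union> (Q - S))" by simp
      also have "\<dots> = card S + card (Q - S)"
        by (rule card_Un_disjoint) (use finite_subset[OF SV fin] finite_subset[OF Q fin] in auto)
      finally have 3: "card (S \<union> Q) = card S + card (Q - S)" .
      \<comment> \<open>Maximality at \<open>S\<close> says that adding \<open>Q - S\<close> does
        not raise the potential, which is the density condition with no excess.\<close>
      have "f (S \<union> Q) \<le> f S" using max[of "S \<union> Q"] SV Q by simp
      then have "int ((i + 1) * card ?F) \<le> int ((2 * i + 1) * card (Q - S))"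
        unfolding f_def 2 3 by (simp add: distrib_left)
      then show "(i + 1) * card ?F \<le> (2 * i + 1) * card (Q - S) + 0" by (simp only: of_nat_le_iff add_0_right)
    qed simp
  qed
  then show False using nc by blast
qed

section \<open>Sharpness\<close>

text \<open>Only \<open>c\<close> is over its capacity, by \<open>j - i + 1\<close>, and summing the
  tokens gives the edge count. A proper vertex set misses \<open>c\<close> or, by
  \<open>reach\<close>, has a token on an edge leaving it. Either way it avoids the one unit by
  which the whole graph is too dense.\<close>

lemma critical_if_tokens:
  fixes x :: "'v \<Rightarrow> 'v \<Rightarrow> int"
  assumes G: "simple_graph G" and i: "i \<ge> 1" and j: "j \<ge> 2 * i + 1" and nc: "\<not> DP_colorable i j G"
    and c: "c \<in> verts G"
    and x: "\<And>a b. {a, b} \<in> edges G \<Longrightarrow> x a b + x b a = int i + 1 \<and> 0 \<le> x a b"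
    and sum_x: "\<And>v. v \<in> verts G \<Longrightarrow>
      (\<Sum>b | {v, b} \<in> edges G. x v b) = (if v = c then int i + int j + 2 else 2 * int i + 1)"
    and reach: "\<And>v. v \<in> verts G \<Longrightarrow> (c, v) \<in> {(a, b). {a, b} \<in> edges G \<and> x a b \<ge> 1}\<^sup>*"
  shows "DP_critical i j G" and "(i + 1) * card (edges G) = (2 * i + 1) * card (verts G) + (j - i) + 1"
proof -
  define E where "E = {(a, b). {a, b} \<in> edges G}"
  have fin: "finite (verts G)" using G by (simp add: simple_graph_def)
  note edge = simple_edge[OF G]
  interpret token_graph "verts G" E "int i + 1"
  proof
    show "E \<subseteq> verts G \<times> verts G" using edge by (auto simp: E_def)
    show "(b, a) \<in> E" if "(a, b) \<in> E" for a b using that by (simp add: E_def insert_commute)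
    show "(a, a) \<notin> E" for a using edge[of a a] unfolding E_def by blast
  qed (use fin i in auto)
  have val: "valid x" unfolding valid_def using x by (auto simp: E_def)
  have tok: "tok x v = (if v = c then int i + int j + 2 else 2 * int i + 1)" if "v \<in> verts G" for v
  proof -
    have "E `` {v} = {b. {v, b} \<in> edges G}" by (auto simp: E_def)
    then show ?thesis unfolding tok_def using sum_x[OF that] by simp
  qed
  have total: "(\<Sum>a\<in>Q. tok x a) = (2 * int i + 1) * int (card Q) + (if c \<in> Q then int j - int i + 1 else 0)"
    if Q: "Q \<subseteq> verts G" for Q
  proof -
    have "(\<Sum>a\<in>Q. tok x a) = (\<Sum>a\<in>Q. 2 * int i + 1 + (if a = c then int j - int i + 1 else 0))"
      by (intro sum.cong refl) (use tok Q in auto)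
    also have "\<dots> = (2 * int i + 1) * int (card Q) + (if c \<in> Q then int j - int i + 1 else 0)"
      using finite_subset[OF Q fin] by (simp add: sum.distrib)
    finally show ?thesis .
  qed
  have pairs: "card (E \<inter> Q \<times> Q) = 2 * card (edges_in G Q)" for Q
  proof -
    have "E \<inter> Q \<times> Q = {(a, b). {a, b} \<in> edges_in G Q}" by (auto simp: E_def edges_in_def)
    also have "card \<dots> = 2 * card (edges_in G Q)"
      by (rule card_ordered_pairs) (use G finite_edges[OF G] in \<open>auto simp: edges_in_def simple_graph_def\<close>)
    finally show ?thesis .
  qed
  have "2 * (\<Sum>a\<in>verts G. tok x a) = (int i + 1) * int (card (E \<inter> verts G \<times> verts G))"
    by (rule sum_tok[OF val]) (use E_sub in auto)
  then have "int ((i + 1) * card (edges G)) = int ((2 * i + 1) * card (verts G) + (j - i) + 1)"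
    using total[OF subset_refl] c j by (simp add: pairs edges_in_verts[OF G] algebra_simps)
  then show tight: "(i + 1) * card (edges G) = (2 * i + 1) * card (verts G) + (j - i) + 1"
    by (simp only: of_nat_eq_iff)
  have sparse: "(i + 1) * card (edges_in G Q) \<le> (2 * i + 1) * card Q + (j - i)"
    if Q: "Q \<subseteq> verts G" "Q \<noteq> verts G" for Q
  proof -
    have "(int i + 1) * int (2 * card (edges_in G Q)) \<le>
        2 * ((2 * int i + 1) * int (card Q) + (int j - int i))"
    proof (cases "c \<in> Q")
      case False
      then show ?thesis using sum_tok_ge(1)[OF val Q(1)] total[OF Q(1)] j by (simp add: pairs)
    next
      case True
      obtain v where v: "v \<in> verts G" "v \<notin> Q" using Q by auto
      have "\<exists>a b. a \<in> Q \<and> b \<notin> Q \<and> (a, b) \<in> E \<and> x a b \<ge> 1"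
        using reach[OF v(1)] v(2)
      proof (induction rule: rtrancl_induct)
        case base
        then show ?case using True by simp
      next
        case (step y z)
        then show ?case by (cases "y \<in> Q") (auto simp: E_def)
      qed
      then obtain a b where "a \<in> Q" "b \<notin> Q" "(a, b) \<in> E" "x a b \<ge> 1" by blast
      then show ?thesis using sum_tok_ge(2)[OF val Q(1), of a b] total[OF Q(1)] True by (simp add: pairs)
    qed
    then have "int ((i + 1) * card (edges_in G Q)) \<le> int ((2 * i + 1) * card Q + (j - i))"
      using j by (simp add: algebra_simps)
    then show ?thesis by (simp only: of_nat_le_iff)
  qed
  have "DP_colorable i j G'" if G': "proper_subgraph G' G" for G'
  proof (rule colorable_if_sparse[OF _ i j])
    show sG': "simple_graph G'" using G' by (simp add: proper_subgraph_def)
    have sub: "verts G' \<subseteq> verts G" "edges G' \<subseteq> edges G" "G' \<noteq> G"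
      using G' by (auto simp: proper_subgraph_def)
    fix Q assume Q: "Q \<subseteq> verts G'"
    show "(i + 1) * card (edges_in G' Q) \<le> (2 * i + 1) * card Q + (j - i)"
    proof (cases "Q = verts G")
      case False
      have "card (edges_in G' Q) \<le> card (edges_in G Q)"
        by (rule card_mono) (use finite_edges[OF G] sub in \<open>auto simp: edges_in_def\<close>)
      then have "(i + 1) * card (edges_in G' Q) \<le> (i + 1) * card (edges_in G Q)" by (rule mult_le_mono2)
      moreover have "Q \<subseteq> verts G" using Q sub(1) by simp
      ultimately show ?thesis using sparse[of Q] False by linarith
    next
      case True
      \<comment> \<open>A spanning proper subgraph lacks an edge, and its \<open>i + 1\<close>
        tokens cover the surplus of one.\<close>
      then have "verts G' = verts G" using Q sub(1) by auto
      then have "edges G' \<subset> edges G" using sub(2,3) by (cases G; cases G') auto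
      then have "card (edges G') < card (edges G)" using finite_edges[OF G] by (rule psubset_card_mono[rotated])
      moreover have "card (edges_in G' Q) \<le> card (edges G')"
        by (rule card_mono) (use finite_edges[OF sG'] in \<open>auto simp: edges_in_def\<close>)
      ultimately have "card (edges_in G' Q) + 1 \<le> card (edges G)" by simp
      then have "(i + 1) * (card (edges_in G' Q) + 1) \<le> (i + 1) * card (edges G)" by (rule mult_le_mono2)
      then show ?thesis using tight True i by simp
    qed
  qed
  then show "DP_critical i j G" using G nc by (auto simp: DP_critical_def)
qed

text \<open>A symmetric relation that forms a matching over each edge is the conflict relation of a
  cover, so an example can be given by its conflicts alone. In the constructed cover, even numbers
  are poor and odd ones rich.\<close>

lemma not_colorable_if_conflicts:
  fixes G :: "nat ugraph" and conf :: "nat \<Rightarrow> bool \<Rightarrow> nat \<Rightarrow> bool \<Rightarrow> bool"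
  assumes G: "simple_graph G"
    and conf_edge: "\<And>a c b d. conf a c b d \<Longrightarrow> {a, b} \<in> edges G"
    and conf_sym: "\<And>a c b d. conf a c b d \<Longrightarrow> conf b d a c"
    and match: "\<And>a b d. conf a True b d \<Longrightarrow> conf a False b d \<Longrightarrow> False"
    and bad: "\<And>\<psi>. (\<And>v. v \<in> verts G \<Longrightarrow> card {u \<in> verts G. conf v (\<psi> v) u (\<psi> u)} \<le> (if \<psi> v then j else i)) \<Longrightarrow> False"
  shows "\<not> DP_colorable i j G"
proof
  assume col: "DP_colorable i j G"
  have match': "c = c'" if "conf a c b d" "conf a c' b d" for a c b d c'
    using match[of a b d] that by (cases c; cases c') simp_all
  define h where "h = (\<lambda>v c. 2 * v + (if c then 1 else 0 :: nat))"
  have h_eq: "h a c = h b d \<longleftrightarrow> a = b \<and> c = d" for a b c d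
    unfolding h_def by (cases c; cases d; simp; presburger)
  define H where "H = \<lparr>verts = {h v c | v c. v \<in> verts G},
    edges = {{h v True, h v False} | v. v \<in> verts G} \<union> {{h a c, h b d} | a c b d. conf a c b d}\<rparr>"
  define L where "L = (\<lambda>v. {h v False, h v True})"
  have hv: "cover_vertex (\<lambda>v. h v False) (\<lambda>v. h v True) v c = h v c" for v c by (simp add: cover_vertex_def)
  note edge = simple_edge[OF G]
  have edgeH: "{h a c, h b d} \<in> edges H \<longleftrightarrow> conf a c b d" if "a \<noteq> b" for a c b d
  proof
    assume "{h a c, h b d} \<in> edges H"
    then consider v where "{h a c, h b d} = {h v True, h v False}"
      | a' c' b' d' where "{h a c, h b d} = {h a' c', h b' d'}" "conf a' c' b' d'" by (auto simp: H_def)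
    then show "conf a c b d"
    proof cases
      case 1
      then show ?thesis using that by (auto simp: doubleton_eq_iff h_eq)
    next
      case 2
      then show ?thesis using conf_sym[OF 2(2)] by (auto simp: doubleton_eq_iff h_eq)
    qed
  next
    assume "conf a c b d"
    then show "{h a c, h b d} \<in> edges H" unfolding H_def by auto
  qed
  have inL: "z \<in> L v \<longleftrightarrow> (\<exists>c. z = h v c)" for z v by (auto simp: L_def) (metis (full_types))
  have between: "e \<in> edges_between H (L u) (L v) \<longleftrightarrow> (\<exists>c d. e = {h u c, h v d} \<and> conf u c v d)" if "u \<noteq> v" for e u v
    using edgeH[OF that] by (auto simp: edges_between_def inL)
  have "two_fold_cover G L H"
    unfolding two_fold_cover_def
  proof (intro conjI ballI allI impI)
    show "simple_graph H" unfolding simple_graph_def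
    proof (intro conjI ballI)
      have "verts H \<subseteq> (\<lambda>(v, c). h v c) ` (verts G \<times> UNIV)" by (auto simp: H_def)
      then show "finite (verts H)" using G finite_subset by (fastforce simp: simple_graph_def)
      fix e assume "e \<in> edges H"
      then consider v where "v \<in> verts G" "e = {h v True, h v False}"
        | a c b d where "conf a c b d" "e = {h a c, h b d}" by (auto simp: H_def)
      then have "e \<subseteq> verts H \<and> card e = 2"
      proof cases
        case 1
        then show ?thesis by (auto simp: H_def h_eq)
      next
        case 2
        then show ?thesis using edge[OF conf_edge[OF 2(1)]] by (auto simp: H_def h_eq)
      qed
      then show "e \<subseteq> verts H" "card e = 2" by auto
    qed
    show "(\<Union>u\<in>verts G. L u) = verts H" unfolding H_def by (auto simp: inL) blast
    show "disjoint_family_on L (verts G)" by (auto simp: disjoint_family_on_def inL h_eq)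
    fix u assume u: "u \<in> verts G"
    show "card (L u) = 2" by (simp add: L_def h_eq)
    have "{h u True, h u False} \<in> edges H" using u by (auto simp: H_def)
    then show "complete_graph (induced H (L u))"
      by (auto simp: complete_graph_def induced_def L_def insert_commute)
  next
    fix u v assume uv: "u \<noteq> v" and "edges_between H (L u) (L v) \<noteq> {}"
    then obtain e where "e \<in> edges_between H (L u) (L v)" by auto
    then obtain c d where "conf u c v d" unfolding between[OF uv] by auto
    then show "{u, v} \<in> edges G" by (rule conf_edge)
  next
    fix u v assume "{u, v} \<in> edges G"
    then have uv: "u \<noteq> v" using edge[of u v] by simp
    show "disjoint (edges_between H (L u) (L v))"
    proof (rule disjointI)
      fix e e' assume e: "e \<in> edges_between H (L u) (L v)" "e' \<in> edges_between H (L u) (L v)" "e \<noteq> e'"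
      obtain c d where 1: "e = {h u c, h v d}" "conf u c v d" using e unfolding between[OF uv] by auto
      obtain c' d' where 2: "e' = {h u c', h v d'}" "conf u c' v d'" using e unfolding between[OF uv] by auto
      have ne: "\<not> (c = c' \<and> d = d')" using e(3) 1(1) 2(1) by blast
      have "d \<noteq> d'" using match'[OF 1(2)] 2(2) ne by blast
      moreover have "c \<noteq> c'" using match'[OF conf_sym[OF 1(2)]] conf_sym[OF 2(2)] ne by blast
      ultimately show "e \<inter> e' = {}" using uv by (auto simp: 1(1) 2(1) h_eq)
    qed
  qed
  moreover have pr: "poor_rich G L (\<lambda>v. h v False) (\<lambda>v. h v True)" by (simp add: poor_rich_def L_def)
  ultimately interpret cover G L H "\<lambda>v. h v False" "\<lambda>v. h v True" using G by unfold_locales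
  have "\<exists>\<phi>. defective_coloring i j G L H (\<lambda>v. h v False) (\<lambda>v. h v True) \<phi>"
    using col two_fold pr unfolding DP_colorable_def by blast
  then obtain \<psi> where \<psi>: "\<And>v. v \<in> verts G \<Longrightarrow>
      card {u \<in> verts G. conflict G H (\<lambda>v. h v False) (\<lambda>v. h v True) v (\<psi> v) u (\<psi> u)} \<le> (if \<psi> v then j else i)"
    unfolding colorable_iff by blast
  have "conflict G H (\<lambda>v. h v False) (\<lambda>v. h v True) a c b d \<longleftrightarrow> conf a c b d" for a b c d
    using conf_edge[of a c b d] edge[of a b] edgeH[of a b c d] by (auto simp: conflict_def hv)
  then show False using bad[of \<psi>] \<psi> by simp
qed

text \<open>The pairs \<open>(k, s)\<close> with \<open>s \<ge> 1\<close> are vertices of degree 2 joined to \<open>(k, 0)\<close> and to its parent. Whatever their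
  color, they conflict with the poor copy of \<open>(k, 0)\<close> or with one fixed copy of the parent, the one given
  by \<open>rich k\<close>. Together with the edge from \<open>(k, 0)\<close> to its parent and the subtree below, they force a
  conflict at that copy of the parent. The root has \<open>j + 1\<close> branches attacking its rich copy and
  \<open>i + 1\<close> attacking its poor copy; the last branch is a path of arbitrary length.\<close>

locale flag_tree =
  fixes i j N :: nat
  assumes i: "i \<ge> 1" and j: "j \<ge> 2 * i + 1" and N: "N \<ge> i + j + 2"
begin

text \<open>The hubs 1 to \<open>i + j + 2\<close> hang on the root 0; all later ones continue the
  last of these branches as a path.\<close>

definition par :: "nat \<Rightarrow> nat" where "par k = (if k \<le> i + j + 2 then 0 else k - 1)"

definition children :: "nat \<Rightarrow> nat set" where "children k = {l. 1 \<le> l \<and> l \<le> N \<and> par l = k}"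

text \<open>The degree-2 vertices at a hub and the hubs below it number \<open>i + 1\<close>
  together, one more than a poor copy tolerates. A hub other than the root has at most one child, so
  the subtraction does not truncate.\<close>

definition mult :: "nat \<Rightarrow> nat" where "mult k = (if k = 0 then 0 else i + 1 - card (children k))"

definition nd :: "nat \<Rightarrow> nat \<Rightarrow> nat" where "nd k s = prod_encode (k, s)"

definition arcs :: "(nat \<times> nat) set" where
  "arcs = {(nd k s, nd (par k) 0) | k s. 1 \<le> k \<and> k \<le> N \<and> s \<le> mult k} \<union>
     {(nd k s, nd k 0) | k s. 1 \<le> k \<and> k \<le> N \<and> 1 \<le> s \<and> s \<le> mult k}"

definition tree :: "nat ugraph" where
  "tree = \<lparr>verts = {nd k s | k s. k \<le> N \<and> s \<le> mult k}, edges = {{a, b} | a b. (a, b) \<in> arcs}\<rparr>"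

definition rich :: "nat \<Rightarrow> bool" where "rich k \<longleftrightarrow> k \<le> j + 1"

text \<open>A hub attacks its parent when rich, a degree-2 vertex when poor; a rich degree-2 vertex
  attacks the poor copy of its own hub.\<close>

definition half :: "nat \<Rightarrow> bool \<Rightarrow> nat \<Rightarrow> bool \<Rightarrow> bool" where
  "half a c b d \<longleftrightarrow> (\<exists>k s. 1 \<le> k \<and> k \<le> N \<and> s \<le> mult k \<and> a = nd k s \<and>
     (b = nd (par k) 0 \<and> d = rich k \<and> c = (s = 0) \<or> 1 \<le> s \<and> b = nd k 0 \<and> c \<and> \<not> d))"

definition conf :: "nat \<Rightarrow> bool \<Rightarrow> nat \<Rightarrow> bool \<Rightarrow> bool" where
  "conf a c b d \<longleftrightarrow> half a c b d \<or> half b d a c"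

text \<open>A degree-2 vertex keeps \<open>i\<close> tokens towards its hub and all towards the
  parent of the hub. A hub keeps \<open>i\<close> towards its parent and one towards each of its
  \<open>i + 1\<close> own degree-2 vertices and child hubs, in total \<open>2 * i + 1\<close>. The
  single tokens on these downward edges make every vertex reachable from the root.\<close>

definition wt :: "nat \<Rightarrow> nat \<Rightarrow> int" where
  "wt a b = (case (prod_decode a, prod_decode b) of ((k, s), (k', s')) \<Rightarrow>
     if s \<ge> 1 then (if k' = k then int i else int i + 1)
     else if s' \<ge> 1 then (if k' = k then 1 else 0)
     else if k' < k then int i else 1)"

section \<open>Shape of the tree and its token assignment\<close>

lemma nd_eq [simp]: "nd k s = nd k' s' \<longleftrightarrow> k = k' \<and> s = s'"
  by (simp add: nd_def)

lemma par_less: "k \<ge> 1 \<Longrightarrow> par k < k"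
  by (simp add: par_def)

lemma wt_nd [simp]: "wt (nd k s) (nd k' s') =
    (if s \<ge> 1 then (if k' = k then int i else int i + 1)
     else if s' \<ge> 1 then (if k' = k then 1 else 0)
     else if k' < k then int i else 1)"
  by (simp add: wt_def nd_def)

lemma finite_children: "finite (children k)"
  by (rule finite_subset[of _ "{..N}"]) (auto simp: children_def)

lemma children_0: "children 0 = {1..i + j + 2}"
  using N by (auto simp: children_def par_def)

lemma card_children: "k \<ge> 1 \<Longrightarrow> card (children k) \<le> 1"
proof -
  assume "k \<ge> 1"
  then have "children k \<subseteq> {k + 1}" by (auto simp: children_def par_def split: if_splits)
  then show ?thesis using card_mono[of "{k + 1}" "children k"] by simp
qed

lemma mult_children: "k \<ge> 1 \<Longrightarrow> mult k + card (children k) = i + 1"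
  using card_children[of k] by (simp add: mult_def)

lemma child_less: "l \<in> children k \<Longrightarrow> k < l"
  using par_less by (auto simp: children_def)

lemma edge_iff: "{a, b} \<in> edges tree \<longleftrightarrow> (a, b) \<in> arcs \<or> (b, a) \<in> arcs"
  by (auto simp: tree_def doubleton_eq_iff)

lemma vertsE:
  assumes "v \<in> verts tree"
  obtains k s where "v = nd k s" "k \<le> N" "s \<le> mult k"
  using assms by (auto simp: tree_def)

lemma nd_verts: "k \<le> N \<Longrightarrow> s \<le> mult k \<Longrightarrow> nd k s \<in> verts tree"
  by (auto simp: tree_def)

lemma arcsE:
  assumes "(a, b) \<in> arcs"
  obtains k s where "1 \<le> k" "k \<le> N" "s \<le> mult k" "a = nd k s" "b = nd (par k) 0"
    | k s where "1 \<le> k" "k \<le> N" "1 \<le> s" "s \<le> mult k" "a = nd k s" "b = nd k 0"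
proof -
  from assms have "(\<exists>k s. 1 \<le> k \<and> k \<le> N \<and> s \<le> mult k \<and> a = nd k s \<and> b = nd (par k) 0) \<or>
      (\<exists>k s. 1 \<le> k \<and> k \<le> N \<and> 1 \<le> s \<and> s \<le> mult k \<and> a = nd k s \<and> b = nd k 0)"
    unfolding arcs_def by blast
  then show thesis using that by blast
qed

lemma arcs_verts:
  assumes "(a, b) \<in> arcs"
  shows "a \<in> verts tree \<and> b \<in> verts tree \<and> a \<noteq> b"
  using assms
proof (cases rule: arcsE)
  case (1 k s)
  then show ?thesis using nd_verts[of k s] nd_verts[of "par k" 0] par_less[of k] by simp
next
  case (2 k s)
  then show ?thesis using nd_verts[of k s] nd_verts[of k 0] by simp
qed

lemma verts_finite: "finite (verts tree)"
proof -
  have "verts tree = (\<Union>k\<in>{..N}. nd k ` {..mult k})" by (auto simp: tree_def)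
  then show ?thesis by simp
qed

lemma simple_tree: "simple_graph tree"
  unfolding simple_graph_def
proof (intro conjI ballI verts_finite)
  fix e assume "e \<in> edges tree"
  then obtain a b where e: "e = {a, b}" "(a, b) \<in> arcs" by (auto simp: tree_def)
  show "e \<subseteq> verts tree" "card e = 2" using arcs_verts[OF e(2)] e(1) by auto
qed

lemma wt_edge:
  assumes "{a, b} \<in> edges tree"
  shows "wt a b + wt b a = int i + 1 \<and> 0 \<le> wt a b"
proof -
  have *: "wt a b + wt b a = int i + 1 \<and> 0 \<le> wt a b \<and> 0 \<le> wt b a" if "(a, b) \<in> arcs" for a b
  proof -
    from that show ?thesis
    proof (cases rule: arcsE)
      case (1 k s)
      then show ?thesis using par_less[of k] by auto
    qed auto
  qed
  from assms consider "(a, b) \<in> arcs" | "(b, a) \<in> arcs" by (auto simp: edge_iff)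
  then show ?thesis
  proof cases
    case 1
    then show ?thesis using *[OF 1] by simp
  next
    case 2
    then show ?thesis using *[OF 2] by simp
  qed
qed

lemma neighbours_leaf:
  assumes "1 \<le> k" "k \<le> N" "1 \<le> s" "s \<le> mult k"
  shows "{b. {nd k s, b} \<in> edges tree} = {nd (par k) 0, nd k 0}"
  unfolding edge_iff using assms by (auto simp: arcs_def)

lemma neighbours_hub:
  assumes "k \<le> N"
  shows "{b. {nd k 0, b} \<in> edges tree} =
    (if k = 0 then {} else {nd (par k) 0}) \<union> nd k ` {1..mult k} \<union> (\<Union>l\<in>children k. nd l ` {0..mult l})"
    (is "?A = ?B")
proof (intro equalityI subsetI)
  fix b assume "b \<in> ?A"
  then consider "(nd k 0, b) \<in> arcs" | "(b, nd k 0) \<in> arcs" by (auto simp: edge_iff)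
  then show "b \<in> ?B" by cases (auto simp: arcs_def children_def)
next
  fix b assume "b \<in> ?B"
  then consider "k \<ge> 1" "b = nd (par k) 0" | s where "1 \<le> s" "s \<le> mult k" "b = nd k s"
    | l s where "l \<in> children k" "s \<le> mult l" "b = nd l s"
    by (auto split: if_splits)
  then show "b \<in> ?A"
  proof cases
    case 1
    then show ?thesis using assms by (auto simp: edge_iff arcs_def)
  next
    case 2
    then have "k \<ge> 1" by (cases k) (auto simp: mult_def)
    then have "(b, nd k 0) \<in> arcs" using 2 assms by (auto simp: arcs_def)
    then show ?thesis by (simp add: edge_iff)
  next
    case 3
    then have "(b, nd k 0) \<in> arcs" by (auto simp: arcs_def children_def)
    then show ?thesis by (simp add: edge_iff)
  qed
qed

lemma sum_hub:
  assumes k: "k \<le> N"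
  shows "(\<Sum>b | {nd k 0, b} \<in> edges tree. wt (nd k 0) b) =
    (if k = 0 then 0 else int i) + int (mult k) + int (card (children k))"
proof -
  let ?A = "if k = 0 then {} else {nd (par k) 0}" and ?B = "nd k ` {1..mult k}"
    and ?C = "\<Union>l\<in>children k. nd l ` {0..mult l}"
  have inj: "inj_on (nd l) X" for l X by (auto simp: inj_on_def)
  have finC: "finite ?C" using finite_children by auto
  have par: "k \<noteq> 0 \<Longrightarrow> par k < k" using par_less[of k] by simp
  have dis: "(?A \<union> ?B) \<inter> ?C = {}" "?A \<inter> ?B = {}"
    using par child_less by (fastforce split: if_splits)+
  have A: "(\<Sum>b\<in>?A. wt (nd k 0) b) = (if k = 0 then 0 else int i)" using par by simp
  have B: "(\<Sum>b\<in>?B. wt (nd k 0) b) = int (mult k)" by (simp add: sum.reindex[OF inj])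
  have "(\<Sum>b\<in>?C. wt (nd k 0) b) = (\<Sum>l\<in>children k. \<Sum>b\<in>nd l ` {0..mult l}. wt (nd k 0) b)"
    by (rule sum.UNION_disjoint) (use finite_children in auto)
  also have "\<dots> = (\<Sum>l\<in>children k. 1)"
  proof (rule sum.cong[OF refl])
    fix l assume l: "l \<in> children k"
    have "(\<Sum>b\<in>nd l ` {0..mult l}. wt (nd k 0) b) = (\<Sum>s\<in>{0..mult l}. if s = 0 then 1 else 0)"
      unfolding sum.reindex[OF inj] o_def by (intro sum.cong) (use child_less[OF l] in auto)
    then show "(\<Sum>b\<in>nd l ` {0..mult l}. wt (nd k 0) b) = 1" by simp
  qed
  finally have C: "(\<Sum>b\<in>?C. wt (nd k 0) b) = int (card (children k))" by simp
  have sum1: "sum (wt (nd k 0)) (?A \<union> ?B \<union> ?C) = sum (wt (nd k 0)) (?A \<union> ?B) + sum (wt (nd k 0)) ?C"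
    by (rule sum.union_disjoint[OF _ finC dis(1)]) simp
  have sum2: "sum (wt (nd k 0)) (?A \<union> ?B) = sum (wt (nd k 0)) ?A + sum (wt (nd k 0)) ?B"
    by (rule sum.union_disjoint[OF _ _ dis(2)]) simp_all
  show ?thesis unfolding neighbours_hub[OF k]
    unfolding sum1 sum2 A B C ..
qed

lemma sum_wt:
  assumes "v \<in> verts tree"
  shows "(\<Sum>b | {v, b} \<in> edges tree. wt v b) = (if v = nd 0 0 then int i + int j + 2 else 2 * int i + 1)"
proof -
  obtain k s where v: "v = nd k s" "k \<le> N" "s \<le> mult k" by (rule vertsE[OF assms])
  show ?thesis
  proof (cases "s = 0")
    case True
    have "card (children 0) = i + j + 2" by (simp add: children_0)
    then show ?thesis using v True sum_hub[of k] mult_children[of k] by (auto simp: mult_def)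
  next
    case False
    then have s: "s \<ge> 1" by simp
    then have k: "k \<ge> 1" using v by (cases k) (auto simp: mult_def)
    show ?thesis unfolding v(1) neighbours_leaf[OF k v(2) s v(3)] using s par_less[OF k] by simp
  qed
qed

lemma reach_wt:
  assumes "v \<in> verts tree"
  shows "(nd 0 0, v) \<in> {(a, b). {a, b} \<in> edges tree \<and> wt a b \<ge> 1}\<^sup>*" (is "_ \<in> ?R\<^sup>*")
proof -
  have hub: "(nd 0 0, nd k 0) \<in> ?R\<^sup>*" if "k \<le> N" for k
    using that
  proof (induction k rule: less_induct)
    case (less k)
    show ?case
    proof (cases "k = 0")
      case False
      then have k: "par k < k" "k \<ge> 1" using par_less[of k] by auto
      have "(nd k 0, nd (par k) 0) \<in> arcs" using k less.prems by (auto simp: arcs_def)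
      then have "(nd (par k) 0, nd k 0) \<in> ?R" using k by (simp add: edge_iff)
      then show ?thesis using less.IH[OF k(1)] k(1) less.prems by (meson le_trans less_imp_le rtrancl.rtrancl_into_rtrancl)
    qed simp
  qed
  obtain k s where v: "v = nd k s" "k \<le> N" "s \<le> mult k" by (rule vertsE[OF assms])
  show ?thesis
  proof (cases "s = 0")
    case True
    then show ?thesis using hub v by simp
  next
    case False
    then have k: "k \<ge> 1" using v by (cases k) (auto simp: mult_def)
    have "(nd k s, nd k 0) \<in> arcs" using k v False by (auto simp: arcs_def)
    then have "(nd k 0, v) \<in> ?R" using v(1) False by (simp add: edge_iff)
    then show ?thesis using hub[OF v(2)] by (rule rtrancl_into_rtrancl[rotated])
  qed
qed

section \<open>Conflicts in the tree\<close>

lemma half_arcs: "half a c b d \<Longrightarrow> (a, b) \<in> arcs"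
  unfolding half_def arcs_def by blast

text \<open>Arcs descend in the lexicographic order of \<open>(k, s)\<close>, so no edge carries
  arcs in both directions and at most one pair of copies conflicts over it.\<close>

lemma arcs_decrease:
  assumes "(a, b) \<in> arcs"
  shows "(prod_decode b, prod_decode a) \<in> less_than <*lex*> less_than"
  using assms by (cases rule: arcsE) (use par_less in \<open>auto simp: nd_def\<close>)

lemma arcs_asym: "(a, b) \<in> arcs \<Longrightarrow> (b, a) \<notin> arcs"
  using arcs_decrease[of a b] arcs_decrease[of b a] by (auto simp: lex_prod_def)

lemma half_fun:
  assumes "half a c b d" "half a c' b d'"
  shows "c = c' \<and> d = d'"
proof -
  have "par k \<noteq> k" "k \<noteq> par k" if "1 \<le> k" for k using par_less[OF that] by simp_all
  then show ?thesis using assms unfolding half_def by auto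
qed

lemma conf_fun:
  assumes "conf a c b d" "conf a c' b d'"
  shows "c = c' \<and> d = d'"
  using assms arcs_asym half_arcs half_fun unfolding conf_def by metis

text \<open>One conflicting vertex is picked for each child in \<open>C\<close>; these are distinct
  from each other and from those at \<open>k\<close> because their first coordinates differ.\<close>

lemma load_ge:
  assumes k: "k \<le> N" and C: "C \<subseteq> children k"
    and kids: "\<And>l. l \<in> C \<Longrightarrow> \<exists>s\<le>mult l. conf (nd k 0) (\<psi> (nd k 0)) (nd l s) (\<psi> (nd l s))"
    and leaves: "\<And>s. s \<in> Z \<Longrightarrow> s \<le> mult k \<and> conf (nd k 0) (\<psi> (nd k 0)) (nd k s) (\<psi> (nd k s))"
  shows "card Z + card C \<le> card {u \<in> verts tree. conf (nd k 0) (\<psi> (nd k 0)) u (\<psi> u)}"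
proof -
  obtain \<sigma> where \<sigma>: "\<And>l. l \<in> C \<Longrightarrow> \<sigma> l \<le> mult l \<and> conf (nd k 0) (\<psi> (nd k 0)) (nd l (\<sigma> l)) (\<psi> (nd l (\<sigma> l)))"
    using kids by metis
  have kC: "k \<notin> C" using C child_less by blast
  have fZ: "finite Z" using leaves by (intro finite_subset[of Z "{..mult k}"]) auto
  have fC: "finite C" using C finite_children finite_subset by blast
  have "card (nd k ` Z \<union> (\<lambda>l. nd l (\<sigma> l)) ` C) = card (nd k ` Z) + card ((\<lambda>l. nd l (\<sigma> l)) ` C)"
    by (rule card_Un_disjoint) (use fZ fC kC in auto)
  also have "\<dots> = card Z + card C"
    by (intro arg_cong2[where f = "(+)"] card_image) (auto simp: inj_on_def)
  finally have "card Z + card C = card (nd k ` Z \<union> (\<lambda>l. nd l (\<sigma> l)) ` C)" ..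
  also have "\<dots> \<le> card {u \<in> verts tree. conf (nd k 0) (\<psi> (nd k 0)) u (\<psi> u)}"
  proof (rule card_mono)
    show "finite {u \<in> verts tree. conf (nd k 0) (\<psi> (nd k 0)) u (\<psi> u)}" using verts_finite by simp
    have "nd l (\<sigma> l) \<in> verts tree" if "l \<in> C" for l
      using \<sigma>[OF that] that C by (intro nd_verts) (auto simp: children_def)
    moreover have "nd k s \<in> verts tree" if "s \<in> Z" for s using leaves[OF that] k by (intro nd_verts) auto
    ultimately show "nd k ` Z \<union> (\<lambda>l. nd l (\<sigma> l)) ` C \<subseteq> {u \<in> verts tree. conf (nd k 0) (\<psi> (nd k 0)) u (\<psi> u)}"
      using \<sigma> leaves by auto
  qed
  finally show ?thesis .
qed

lemma not_colorable_tree: "\<not> DP_colorable i j tree"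
proof (rule not_colorable_if_conflicts[where conf = conf, OF simple_tree])
  show "{a, b} \<in> edges tree" if "conf a c b d" for a c b d
    using that half_arcs by (auto simp: conf_def edge_iff)
  show "conf b d a c" if "conf a c b d" for a c b d using that by (auto simp: conf_def)
  show False if "conf a True b d" "conf a False b d" for a b d using conf_fun[OF that] by simp
  fix \<psi> :: "nat \<Rightarrow> bool"
  assume good: "\<And>v. v \<in> verts tree \<Longrightarrow> card {u \<in> verts tree. conf v (\<psi> v) u (\<psi> u)} \<le> (if \<psi> v then j else i)"
  \<comment> \<open>The induction runs from the bottom upwards. If branch \<open>k\<close> spared
    its target copy, hub \<open>k\<close> would be poor and its degree-2 vertices rich; together
    with the branches below they would cause \<open>i + 1\<close> conflicts at the poor hub.\<close>
  have claim: "\<exists>s\<le>mult k. conf (nd (par k) 0) (rich k) (nd k s) (\<psi> (nd k s))" if "1 \<le> k" "k \<le> N" for k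
    using that
  proof (induction "N - k" arbitrary: k rule: less_induct)
    case less
    note k = less.prems
    show ?case
    proof (rule ccontr)
      assume neg: "\<not> ?thesis"
      have up: "conf (nd (par k) 0) (rich k) (nd k s) (s = 0)" if "s \<le> mult k" for s
        using that k by (auto simp: conf_def half_def)
      have \<psi>k: "\<psi> (nd k s) \<noteq> (s = 0)" if "s \<le> mult k" for s
        using up[OF that] neg that by (cases "\<psi> (nd k s)"; cases "s = 0") auto
      have \<psi>0: "\<not> \<psi> (nd k 0)" using \<psi>k[of 0] by simp
      have "card {1..mult k} + card (children k) \<le>
          card {u \<in> verts tree. conf (nd k 0) (\<psi> (nd k 0)) u (\<psi> u)}"
      proof (rule load_ge[OF k(2) subset_refl])
        fix l assume l: "l \<in> children k"
        then have l': "1 \<le> l" "l \<le> N" "par l = k" "k < l" using child_less by (auto simp: children_def)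
        \<comment> \<open>A child of a hub other than the root lies on the long path and attacks a
          poor copy.\<close>
        have "\<not> rich l" using l' k by (auto simp: rich_def par_def split: if_splits)
        moreover have "\<exists>s\<le>mult l. conf (nd (par l) 0) (rich l) (nd l s) (\<psi> (nd l s))"
          by (rule less.hyps) (use l' in auto)
        ultimately show "\<exists>s\<le>mult l. conf (nd k 0) (\<psi> (nd k 0)) (nd l s) (\<psi> (nd l s))"
          using \<psi>0 l'(3) by simp
      next
        fix s assume s: "s \<in> {1..mult k}"
        then have "\<psi> (nd k s)" using \<psi>k[of s] by auto
        moreover have "half (nd k s) True (nd k 0) False" using s k by (auto simp: half_def)
        ultimately show "s \<le> mult k \<and> conf (nd k 0) (\<psi> (nd k 0)) (nd k s) (\<psi> (nd k s))"
          using s \<psi>0 by (simp add: conf_def)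
      qed
      also have "\<dots> \<le> (if \<psi> (nd k 0) then j else i)" by (rule good) (use nd_verts k in simp)
      finally show False using mult_children[OF k(1)] \<psi>0 by simp
    qed
  qed
  \<comment> \<open>The branches attacking the color chosen at the root: \<open>j + 1\<close> if it
    is rich, \<open>i + 1\<close> if it is poor.\<close>
  define C where "C = {l \<in> children 0. rich l = \<psi> (nd 0 0)}"
  have "card ({} :: nat set) + card C \<le> card {u \<in> verts tree. conf (nd 0 0) (\<psi> (nd 0 0)) u (\<psi> u)}"
  proof (rule load_ge)
    fix l assume l: "l \<in> C"
    then have "1 \<le> l" "l \<le> N" "par l = 0" "rich l = \<psi> (nd 0 0)" by (auto simp: C_def children_def)
    then show "\<exists>s\<le>mult l. conf (nd 0 0) (\<psi> (nd 0 0)) (nd l s) (\<psi> (nd l s))" using claim[of l] by simp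
  qed (auto simp: C_def)
  also have "\<dots> \<le> (if \<psi> (nd 0 0) then j else i)" by (rule good) (use nd_verts in simp)
  finally have le: "card C \<le> (if \<psi> (nd 0 0) then j else i)" by simp
  show False
  proof (cases "\<psi> (nd 0 0)")
    case True
    then have "C = {1..j + 1}" by (auto simp: C_def children_0 rich_def)
    then show False using le True by simp
  next
    case False
    then have "C = {j + 2..i + j + 2}" by (auto simp: C_def children_0 rich_def)
    then show False using le False by simp
  qed
qed

lemma tree_critical: "DP_critical i j tree"
  and tree_edges: "(i + 1) * card (edges tree) = (2 * i + 1) * card (verts tree) + (j - i) + 1"
  using critical_if_tokens[OF simple_tree i j not_colorable_tree nd_verts[of 0 0] wt_edge sum_wt reach_wt]
  by simp_all

lemma card_tree: "card (verts tree) \<ge> N"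
proof -
  have "(\<lambda>k. nd k 0) ` {1..N} \<subseteq> verts tree" using nd_verts by auto
  then have "card ((\<lambda>k. nd k 0) ` {1..N}) \<le> card (verts tree)" using verts_finite by (rule card_mono[rotated])
  also have "card ((\<lambda>k. nd k 0) ` {1..N}) = N" by (subst card_image) (auto simp: inj_on_def)
  finally show ?thesis .
qed

end

section \<open>Clearing the denominator in the bound\<close>

lemma real_tight_iff:
  assumes "j \<ge> (i :: nat)"
  shows "real e = ((2 * real i + 1) * real n + real j - real i + 1) / (real i + 1) \<longleftrightarrow>
      (i + 1) * e = (2 * i + 1) * n + (j - i) + 1" (is "?A \<longleftrightarrow> ?B")
    and "real e \<ge> ((2 * real i + 1) * real n + real j - real i + 1) / (real i + 1) \<longleftrightarrow>
      (i + 1) * e > (2 * i + 1) * n + (j - i)" (is "?C \<longleftrightarrow> ?D")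
proof -
  have r: "(2 * real i + 1) * real n + real j - real i + 1 = real ((2 * i + 1) * n + (j - i) + 1)"
    using assms by (simp add: of_nat_diff algebra_simps)
  have e: "real e * (real i + 1) = real ((i + 1) * e)" by (simp add: algebra_simps)
  have pos: "real i + 1 > 0" by simp
  have "?A \<longleftrightarrow> real e * (real i + 1) = real ((2 * i + 1) * n + (j - i) + 1)"
    unfolding r using pos by (simp add: nonzero_eq_divide_eq)
  then show "?A \<longleftrightarrow> ?B" unfolding e by (simp only: of_nat_eq_iff)
  have "?C \<longleftrightarrow> real ((2 * i + 1) * n + (j - i) + 1) \<le> real e * (real i + 1)"
    unfolding r using pos by (simp add: pos_divide_le_eq)
  also have "\<dots> \<longleftrightarrow> (2 * i + 1) * n + (j - i) + 1 \<le> (i + 1) * e" unfolding e by (simp only: of_nat_le_iff)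
  finally show "?C \<longleftrightarrow> ?D" by auto
qed

theorem theorem2p1:
  fixes i j :: nat
  assumes "i \<ge> 3" and "j \<ge> 2 * i + 1"
  shows "(\<forall>(n::nat) (G :: 'v ugraph).
            simple_graph G \<and> card (verts G) = n \<and> DP_critical i j G \<longrightarrow>
            real (card (edges G)) \<ge> ((2 * real i + 1) * real n + real j - real i + 1) / (real i + 1))
       \<and> (\<forall>n::nat. ereal_of_enat (g_DP i j n)
            \<ge> ereal (((2 * real i + 1) * real n + real j - real i + 1) / (real i + 1)))
       \<and> infinite {n::nat. \<exists>G :: nat ugraph.
            simple_graph G \<and> card (verts G) = n \<and> DP_critical i j G \<and>
            real (card (edges G)) = ((2 * real i + 1) * real n + real j - real i + 1) / (real i + 1)}"
proof (intro conjI allI impI, elim conjE)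
  have i: "i \<ge> 1" and ij: "i \<le> j" using assms by auto
  fix n and G :: "'v ugraph" assume "card (verts G) = n" and "DP_critical i j G"
  then show "real (card (edges G)) \<ge> ((2 * real i + 1) * real n + real j - real i + 1) / (real i + 1)"
    unfolding real_tight_iff(2)[OF ij] using critical_edges[OF _ i assms(2)] by blast
next
  have i: "i \<ge> 1" and ij: "i \<le> j" using assms by auto
  fix n
  let ?b = "((2 * real i + 1) * real n + real j - real i + 1) / (real i + 1)"
  let ?S = "{G :: nat ugraph. DP_critical i j G \<and> card (verts G) = n}"
  have bound: "?b \<le> real (card (edges G))" if "G \<in> ?S" for G
    unfolding real_tight_iff(2)[OF ij] using critical_edges[of i j G, OF _ i assms(2)] that by auto
  show "ereal_of_enat (g_DP i j n) \<ge> ereal ?b"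
  \<comment> \<open>Without critical graphs on \<open>n\<close> vertices the infimum is infinite;
    otherwise it is attained.\<close>
  proof (cases "?S = {}")
    case True
    have "g_DP i j n = \<infinity>" unfolding g_DP_def True by (simp add: top_enat_def)
    then show ?thesis by simp
  next
    case False
    then obtain G0 where "G0 \<in> ?S" by blast
    then have "g_DP i j n \<in> (\<lambda>G. enat (card (edges G))) ` ?S"
      unfolding g_DP_def by (rule wellorder_InfI[OF imageI])
    then obtain G where "G \<in> ?S" "g_DP i j n = enat (card (edges G))" by auto
    then show ?thesis using bound by simp
  qed
next
  have i: "i \<ge> 1" and ij: "i \<le> j" using assms by auto
  show "infinite {n::nat. \<exists>G :: nat ugraph.
            simple_graph G \<and> card (verts G) = n \<and> DP_critical i j G \<and>
            real (card (edges G)) = ((2 * real i + 1) * real n + real j - real i + 1) / (real i + 1)}"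
    unfolding infinite_nat_iff_unbounded_le
  proof
    fix m
    \<comment> \<open>Lengthening the last branch by \<open>m\<close> hubs gives a tight example
      with at least \<open>m\<close> vertices.\<close>
    interpret flag_tree i j "i + j + 2 + m" using i assms(2) by unfold_locales auto
    show "\<exists>n\<ge>m. n \<in> {n. \<exists>G :: nat ugraph.
            simple_graph G \<and> card (verts G) = n \<and> DP_critical i j G \<and>
            real (card (edges G)) = ((2 * real i + 1) * real n + real j - real i + 1) / (real i + 1)}"
      unfolding mem_Collect_eq real_tight_iff(1)[OF ij]
      using card_tree simple_tree tree_critical tree_edges
      by (intro exI[of _ "card (verts tree)"]) auto
  qed
qed

end
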